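(* Let $n\ge 1$ be an integer. For every nonempty $A\subset\{0,1\}^n$ with $|A|\le\frac12$, $$\mathbf{E} h_A \ge \frac{|A|}{|\partial A|}\, |A|\log_2(1/|A|).$$
   Context: The Hamming cube is the graph with vertex set $\{0,1\}^n$ in which two points are joined by an edge if and only if they differ in exactly one coordinate. For $f:\{0,1\}^n\to\mathbb{R}$, $\mathbf{E} f = 2^{-n}\sum_{x\in\{0,1\}^n} f(x)$. For $S\subset\{0,1\}^n$, $|S|=\mathbf{E}\mathbf{1}_S$ denotes the normalized counting measure of $S$ (not its cardinality). For $x\in A$, $h_A(x)$ is the number of edges connecting $x$ with $\{0,1\}^n\setminus A$; for $x\notin A$, $h_A(x)=0$. The (inner) vertex boundary $\partial A$ is the support of $h_A$, i.e. $\partial A=\{x : h_A(x)\neq 0\}\subset A$. *)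

theory Defs
  imports "HOL-Analysis.Analysis"
begin

(* A point of {0,1}^n is a Boolean list of length n. All definitions carry n explicitly;
   sets and functions are only ever evaluated on hamming_cube n. *)

definition hamming_cube :: "nat \<Rightarrow> bool list set" where
  "hamming_cube n = {x. length x = n}"

definition hamming_edges :: "nat \<Rightarrow> bool list set set" where
  "hamming_edges n =
    {{x, y} | x y. x \<in> hamming_cube n \<and> y \<in> hamming_cube n \<and> (\<exists>!i. i < n \<and> x ! i \<noteq> y ! i)}"

definition cube_expectation :: "nat \<Rightarrow> (bool list \<Rightarrow> real) \<Rightarrow> real" where
  "cube_expectation n f = (\<Sum>x\<in>hamming_cube n. f x) / 2 ^ n"

definition cube_measure :: "nat \<Rightarrow> bool list set \<Rightarrow> real" where
  "cube_measure n S = cube_expectation n (indicator S)"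

definition boundary_degree :: "nat \<Rightarrow> bool list set \<Rightarrow> bool list \<Rightarrow> nat" where
  "boundary_degree n A x =
    (if x \<in> A then card {e \<in> hamming_edges n. \<exists>y \<in> hamming_cube n - A. e = {x, y}} else 0)"

definition vertex_boundary :: "nat \<Rightarrow> bool list set \<Rightarrow> bool list set" where
  "vertex_boundary n A = {x \<in> hamming_cube n. boundary_degree n A x \<noteq> 0}"

end

theory Submission
  imports Defs
begin

text \<open>Write \<open>a\<close>, \<open>e\<close>, \<open>m\<close> for the measure of \<open>A\<close>, the expectation of \<open>h_A\<close> and the measure of the
vertex boundary.  The claim is \<open>sqrt (e * m) \<ge> f a\<close> with \<open>f a = a * sqrt (log 2 (1 / a))\<close>
(\<open>subcube_bound\<close> below), and subcubes give equality.

The proof is an induction on the dimension.  Cut the cube into two opposite faces, and let \<open>A\<close>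
meet them in sets of relative measure \<open>x \<le> y\<close> with data \<open>(e1, m1)\<close> and \<open>(e0, m0)\<close>; put
\<open>d = y - x\<close>.  The points of the larger section that are missing in the smaller one have measure at
least \<open>d\<close>; each of them gains an edge and lies in the boundary.  Hence \<open>2 * e \<ge> e0 + d + e1\<close> and
\<open>2 * m \<ge> max m0 d + m1\<close>, and by Cauchy-Schwarz
\<open>2 * sqrt (e * m) \<ge> sqrt ((e0 + d) * max m0 d) + sqrt (e1 * m1)\<close>.
If \<open>sqrt (e * m) \<ge> B a\<close> and \<open>e \<ge> g a\<close> hold in the lower dimension, the first root is at least
\<open>sqrt (d^2 + max ((B y)^2) (d * g y))\<close>.  So \<open>sqrt (e * m) \<ge> B a\<close> propagates as soon as \<open>B\<close> vanishes at 0
and 1 and satisfies the two-point inequality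
\<open>2 * B ((x + y) / 2) \<le> sqrt ((y - x)^2 + max ((B y)^2) ((y - x) * g y)) + B x\<close> (\<open>profile_two_point\<close>).
The function \<open>g\<close> is a piecewise linear edge-isoperimetric bound, which propagates in the same way.

It remains to find \<open>B \<ge> f\<close> on \<open>[0, 1/2]\<close>.  For \<open>y \<le> 1/2\<close> the function \<open>f\<close> itself works
(\<open>subcube_bound_two_point\<close>), but sections of measure above 1/2 occur, and there \<open>B\<close> has to come down to
\<open>B 1 = 0\<close>.  For \<open>d\<close> tending to 0 the inequality becomes \<open>B * B'' \<ge> -2\<close>.  A continuation of
\<open>f\<close> beyond 1/2 under this constraint reaches 0 only after 1, since \<open>f\<close> is too steep at 1/2.  Therefore
\<open>f\<close> is replaced, already a little above 1/4, by a slightly larger parabola \<open>cap\<close> with the same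
value and a smaller slope at 1/2; from 0.54 on, where \<open>cap\<close> is maximal, a polynomial \<open>tail\<close> of
degree 6 with \<open>tail * tail'' \<ge> -2\<close> leads to 0 at 1.

For \<open>tail\<close> alone the two-point inequality is a convexity argument (\<open>concave_two_point\<close>); for \<open>f\<close> alone
it rescales to an inequality in one variable; the mixed cases are polynomial inequalities in two variables on
rectangles, after \<open>f\<close> has been replaced by chords and tangents.  These are proved by a verified
subdivision procedure on integer coefficients (\<open>pval_nonneg\<close>).\<close>

section \<open>Nonnegativity of polynomials on the unit square\<close>

fun eval1 :: "int list \<Rightarrow> real \<Rightarrow> real" where
  "eval1 [] t = 0"
| "eval1 (c # p) t = of_int c + t * eval1 p t"

fun eval2 :: "int list list \<Rightarrow> real \<Rightarrow> real \<Rightarrow> real" where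
  "eval2 [] s t = 0"
| "eval2 (p # P) s t = eval1 p t + s * eval2 P s t"

text \<open>Reading a polynomial by Horner's scheme, the part that is multiplied by \<open>t\<close> contributes at least the
minimum of 0 and its own lower bound, as long as \<open>t\<close> lies in \<open>[0, 1]\<close>.  The loss is of second
order in the size of the rectangle, so that few subdivisions are needed.\<close>
fun lower1 :: "int list \<Rightarrow> int" where
  "lower1 [] = 0"
| "lower1 (c # p) = c + min 0 (lower1 p)"

fun lower2 :: "int list list \<Rightarrow> int" where
  "lower2 [] = 0"
| "lower2 (p # P) = lower1 p + min 0 (lower2 P)"

fun add1 :: "int list \<Rightarrow> int list \<Rightarrow> int list" where
  "add1 [] q = q"
| "add1 (c # p) [] = c # p"
| "add1 (c # p) (d # q) = (c + d) # add1 p q"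

fun add2 :: "int list list \<Rightarrow> int list list \<Rightarrow> int list list" where
  "add2 [] Q = Q"
| "add2 (p # P) [] = p # P"
| "add2 (p # P) (q # Q) = add1 p q # add2 P Q"

fun mult1 :: "int list \<Rightarrow> int list \<Rightarrow> int list" where
  "mult1 [] q = []"
| "mult1 (c # p) q = add1 (map ((*) c) q) (0 # mult1 p q)"

fun mult2 :: "int list list \<Rightarrow> int list list \<Rightarrow> int list list" where
  "mult2 [] Q = []"
| "mult2 (p # P) Q = add2 (map (mult1 p) Q) ([] # mult2 P Q)"

text \<open>The coefficients of \<open>2 ^ (length p - 1) * p (t / 2)\<close>: the left half of the unit interval is
stretched to the unit interval, and the power of 2 keeps the coefficients integral.  The right half is reached by a
further shift by 1.\<close>
fun halve1 :: "int list \<Rightarrow> int list" where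
  "halve1 [] = []"
| "halve1 (c # p) = 2 ^ length p * c # halve1 p"

fun halve2 :: "int list list \<Rightarrow> int list list" where
  "halve2 [] = []"
| "halve2 (p # P) = map ((*) (2 ^ length P)) p # halve2 P"

fun shift1 :: "int list \<Rightarrow> int list" where
  "shift1 [] = []"
| "shift1 (c # p) = (let q = shift1 p in add1 (c # q) q)"

fun shift2 :: "int list list \<Rightarrow> int list list" where
  "shift2 [] = []"
| "shift2 (p # P) = (let Q = shift2 P in add2 (p # Q) Q)"

text \<open>Bisection in the second variable acts on the rows; since these may differ in length, they are brought to a common
power of 2.\<close>
definition halve_inner :: "int list list \<Rightarrow> int list list" where
  "halve_inner P = (let n = foldr (\<lambda>p. max (length p)) P 0
     in map (\<lambda>p. map ((*) (2 ^ (n - length p))) (halve1 p)) P)"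

text \<open>The list prescribes in which variable the unit square is bisected next (\<open>True\<close> for the first
one) whenever the Horner bound is negative.  Nested conditionals instead of conjunctions make the simplifier evaluate
the second half only if the first one has succeeded.\<close>
fun nonneg_check :: "bool list \<Rightarrow> int list list \<Rightarrow> bool" where
  "nonneg_check [] P = (0 \<le> lower2 P)"
| "nonneg_check (d # ds) P = (if 0 \<le> lower2 P then True else
     if d then (let Q = halve2 P in if nonneg_check ds Q then nonneg_check ds (shift2 Q) else False)
     else (let Q = halve_inner P in
       if nonneg_check ds Q then nonneg_check ds (map shift1 Q) else False))"

lemma min_le_mult:
  fixes a x s :: real
  assumes "a \<le> x" "0 \<le> s" "s \<le> 1"
  shows "min 0 a \<le> s * x"
proof (cases "0 \<le> x")
  case False
  then have "x \<le> s * x" using assms by (simp add: mult_le_cancel_right1)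
  then show ?thesis using assms by linarith
qed (use assms in \<open>simp add: min.coboundedI1\<close>)

lemma lower1_le: "0 \<le> t \<Longrightarrow> t \<le> 1 \<Longrightarrow> real_of_int (lower1 p) \<le> eval1 p t"
proof (induction p)
  case (Cons c p)
  then show ?case using min_le_mult[of "real_of_int (lower1 p)" "eval1 p t" t] by simp
qed simp

lemma lower2_le:
  "0 \<le> s \<Longrightarrow> s \<le> 1 \<Longrightarrow> 0 \<le> t \<Longrightarrow> t \<le> 1 \<Longrightarrow> real_of_int (lower2 P) \<le> eval2 P s t"
proof (induction P)
  case (Cons p P)
  then show ?case
    using min_le_mult[of "real_of_int (lower2 P)" "eval2 P s t" s] lower1_le[of t p] by simp
qed simp

lemma eval_add1: "eval1 (add1 p q) t = eval1 p t + eval1 q t"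
  by (induction p q rule: add1.induct) (auto simp: algebra_simps)

lemma eval_add2: "eval2 (add2 P Q) s t = eval2 P s t + eval2 Q s t"
  by (induction P Q rule: add2.induct) (auto simp: algebra_simps eval_add1)

lemma eval_scale1: "eval1 (map ((*) c) p) t = of_int c * eval1 p t"
  by (induction p) (auto simp: algebra_simps)

lemma eval_scale2: "eval2 (map (map ((*) c)) P) s t = of_int c * eval2 P s t"
  by (induction P) (simp_all add: eval_scale1 distrib_left mult.left_commute)

lemma eval_mult1: "eval1 (mult1 p q) t = eval1 p t * eval1 q t"
  by (induction p) (auto simp: algebra_simps eval_add1 eval_scale1)

lemma eval_map_mult1: "eval2 (map (mult1 p) Q) s t = eval1 p t * eval2 Q s t"
  by (induction Q) (auto simp: algebra_simps eval_mult1)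

lemma eval_mult2: "eval2 (mult2 P Q) s t = eval2 P s t * eval2 Q s t"
  by (induction P) (auto simp: algebra_simps eval_add2 eval_map_mult1)

lemma eval_shift1: "eval1 (shift1 p) t = eval1 p (1 + t)"
  by (induction p) (auto simp: algebra_simps eval_add1 Let_def)

lemma eval_shift2: "eval2 (shift2 P) s t = eval2 P (1 + s) t"
  by (induction P) (auto simp: algebra_simps eval_add2 Let_def)

lemma eval_map_shift1: "eval2 (map shift1 P) s t = eval2 P s (1 + t)"
  by (induction P) (auto simp: eval_shift1)

lemma eval_halve1: "2 * eval1 (halve1 p) (2 * t) = 2 ^ length p * eval1 p t"
  by (induction p) (auto simp: algebra_simps)

lemma eval_halve2: "2 * eval2 (halve2 P) (2 * s) t = 2 ^ length P * eval2 P s t"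
  by (induction P) (auto simp: algebra_simps eval_scale1)

lemma eval_halve_inner:
  "\<exists>n. 2 * eval2 (halve_inner P) s (2 * t) = 2 ^ n * eval2 P s t"
proof -
  have *: "2 * eval2 (map (\<lambda>p. map ((*) (2 ^ (n - length p))) (halve1 p)) P) s (2 * t)
      = 2 ^ n * eval2 P s t" if "\<forall>p\<in>set P. length p \<le> n" for n
    using that
  proof (induction P)
    case (Cons p P)
    have "2 * (2 ^ (n - length p) * eval1 (halve1 p) (2 * t))
        = 2 ^ (n - length p) * (2 ^ length p * eval1 p t)"
      using eval_halve1[of p t] by simp
    also have "\<dots> = 2 ^ n * eval1 p t"
      using Cons.prems by (simp flip: power_add mult.assoc)
    finally have "2 * eval1 (map ((*) (2 ^ (n - length p))) (halve1 p)) (2 * t) = 2 ^ n * eval1 p t"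
      by (simp add: eval_scale1)
    moreover have "2 * eval2 (map (\<lambda>p. map ((*) (2 ^ (n - length p))) (halve1 p)) P) s (2 * t)
        = 2 ^ n * eval2 P s t"
      using Cons by simp
    ultimately show ?case by (simp add: distrib_left mult.left_commute)
  qed simp
  have "\<forall>p\<in>set P. length p \<le> foldr (\<lambda>p. max (length p)) P 0"
    by (induction P) auto
  then show ?thesis using * unfolding halve_inner_def Let_def by blast
qed

lemma nonneg_check_sound:
  "nonneg_check ds P \<Longrightarrow> 0 \<le> s \<Longrightarrow> s \<le> 1 \<Longrightarrow> 0 \<le> t \<Longrightarrow> t \<le> 1 \<Longrightarrow> 0 \<le> eval2 P s t"
proof (induction ds arbitrary: P s t)
  case Nil
  then show ?case using lower2_le[of s t P] by simp
next
  case (Cons d ds)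
  show ?case
  proof (cases "0 \<le> lower2 P")
    case True
    then show ?thesis using lower2_le[of s t P] Cons.prems by simp
  next
    case False
    show ?thesis
    proof (cases d)
      case True
      have "0 \<le> eval2 (halve2 P) (2 * s) t"
      proof (cases "2 * s \<le> 1")
        case True
        then show ?thesis using Cons False \<open>d\<close> by (auto simp: Let_def split: if_splits)
      next
        case half: False
        have "nonneg_check ds (shift2 (halve2 P))"
          using Cons.prems False \<open>d\<close> by (auto simp: Let_def split: if_splits)
        then have "0 \<le> eval2 (shift2 (halve2 P)) (2 * s - 1) t"
          using Cons.prems half by (intro Cons.IH) auto
        then show ?thesis by (simp add: eval_shift2)
      qed
      then show ?thesis using eval_halve2[of P s t]
        by (smt (verit) mult_pos_neg zero_less_power)
    next
      case nd: False
      have "0 \<le> eval2 (halve_inner P) s (2 * t)"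
      proof (cases "2 * t \<le> 1")
        case True
        then show ?thesis using Cons False nd by (auto simp: Let_def split: if_splits)
      next
        case half: False
        have "nonneg_check ds (map shift1 (halve_inner P))"
          using Cons.prems False nd by (auto simp: Let_def split: if_splits)
        then have "0 \<le> eval2 (map shift1 (halve_inner P)) s (2 * t - 1)"
          using Cons.prems half by (intro Cons.IH) auto
        then show ?thesis by (simp add: eval_map_shift1)
      qed
      then show ?thesis using eval_halve_inner[of P s t]
        by (smt (verit) mult_pos_neg zero_less_power)
    qed
  qed
qed

text \<open>Polynomials are entered as expressions, so that the inequalities below can be read; \<open>coeffs\<close>
turns an expression into a common denominator and an integer coefficient matrix.\<close>
datatype pexp = Vs | Vt | Frac int int | Add pexp pexp | Sub pexp pexp | Mul pexp pexp

fun pval :: "pexp \<Rightarrow> real \<Rightarrow> real \<Rightarrow> real" where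
  "pval Vs s t = s"
| "pval Vt s t = t"
| "pval (Frac a b) s t = of_int a / of_int b"
| "pval (Add e f) s t = pval e s t + pval f s t"
| "pval (Sub e f) s t = pval e s t - pval f s t"
| "pval (Mul e f) s t = pval e s t * pval f s t"

fun coeffs :: "pexp \<Rightarrow> int \<times> int list list" where
  "coeffs Vs = (1, [[], [1]])"
| "coeffs Vt = (1, [[0, 1]])"
| "coeffs (Frac a b) = (b, [[a]])"
| "coeffs (Add e f) = (case coeffs e of (b, P) \<Rightarrow> case coeffs f of (c, Q) \<Rightarrow>
     (b * c, add2 (map (map ((*) c)) P) (map (map ((*) b)) Q)))"
| "coeffs (Sub e f) = (case coeffs e of (b, P) \<Rightarrow> case coeffs f of (c, Q) \<Rightarrow>
     (b * c, add2 (map (map ((*) c)) P) (map (map ((*) (- b))) Q)))"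
| "coeffs (Mul e f) = (case coeffs e of (b, P) \<Rightarrow> case coeffs f of (c, Q) \<Rightarrow>
     (b * c, mult2 P Q))"

lemma eval_coeffs:
  "coeffs e = (b, P) \<Longrightarrow> b \<noteq> 0 \<Longrightarrow> eval2 P s t = of_int b * pval e s t"
proof (induction e arbitrary: b P)
  case (Add e f)
  then show ?case
    by (auto split: prod.splits simp: eval_add2 eval_scale2 algebra_simps)
next
  case (Sub e f)
  then show ?case
    by (auto split: prod.splits simp: eval_add2 eval_scale2 algebra_simps)
next
  case (Mul e f)
  then show ?case
    by (auto split: prod.splits simp: eval_mult2 algebra_simps)
qed auto

text \<open>A factor \<open>s ^ k\<close> of the polynomial is split off.  It is present where an inequality
degenerates for \<open>s = 0\<close>, and subdivision alone could not deal with such a zero.\<close>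
fun strip_zero_rows :: "int list list \<Rightarrow> int list list" where
  "strip_zero_rows [] = []"
| "strip_zero_rows (p # P) = (if list_all ((=) 0) p then strip_zero_rows P else p # P)"

lemma eval_zero_row: "list_all ((=) 0) p \<Longrightarrow> eval1 p t = 0"
  by (induction p) auto

lemma eval_strip_nonneg:
  "0 \<le> s \<Longrightarrow> 0 \<le> eval2 (strip_zero_rows P) s t \<Longrightarrow> 0 \<le> eval2 P s t"
  by (induction P) (auto simp: eval_zero_row split: if_splits)

definition nonneg_on_square :: "bool list \<Rightarrow> pexp \<Rightarrow> bool" where
  "nonneg_on_square ds e = (case coeffs e of (b, P) \<Rightarrow>
     if 0 < b then nonneg_check ds (strip_zero_rows P) else False)"

lemma pval_nonneg:
  assumes "nonneg_on_square ds e" "0 \<le> s" "s \<le> 1" "0 \<le> t" "t \<le> 1"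
  shows "0 \<le> pval e s t"
proof -
  obtain b P where bP: "coeffs e = (b, P)" by fastforce
  then have "0 < b" "nonneg_check ds (strip_zero_rows P)"
    using assms(1) by (auto simp: nonneg_on_square_def split: if_splits)
  then have "0 \<le> of_int b * pval e s t"
    using eval_strip_nonneg[of s P t] nonneg_check_sound[of ds _ s t] eval_coeffs[OF bP] assms
    by simp
  then show ?thesis using \<open>0 < b\<close> by (simp add: zero_le_mult_iff)
qed

abbreviation Sq :: "pexp \<Rightarrow> pexp" where "Sq e \<equiv> Mul e e"
abbreviation Num :: "int \<Rightarrow> pexp" where "Num a \<equiv> Frac a 1"

section \<open>The subcube bound\<close>

lemma inverse_ln2_bounds: "1.44 \<le> 1 / ln (2::real)" "1 / ln (2::real) \<le> 1.45"
proof -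
  have "ln (2::real) \<in> {307/443<..<4615/6658}"
    using ln_approx_bounds[of 2 3] by (simp add: eval_nat_numeral)
  then show "1.44 \<le> 1 / ln (2::real)" "1 / ln (2::real) \<le> 1.45"
    by (auto simp: field_simps)
qed

text \<open>The value of \<open>sqrt (e * m)\<close> for a subcube of measure \<open>x\<close>.\<close>
definition subcube_bound :: "real \<Rightarrow> real" where
  "subcube_bound x = x * sqrt (log 2 (1 / x))"

lemma subcube_bound_0 [simp]: "subcube_bound 0 = 0"
  by (simp add: subcube_bound_def)

lemma log_inverse_nonneg: "0 \<le> x \<Longrightarrow> x \<le> 1 \<Longrightarrow> 0 \<le> log 2 (1 / x)"
  by (cases "x = 0") (auto simp: log_def)

lemma subcube_bound_nonneg: "0 \<le> x \<Longrightarrow> x \<le> 1 \<Longrightarrow> 0 \<le> subcube_bound x"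
  by (simp add: subcube_bound_def log_inverse_nonneg)

text \<open>With \<open>L = log 2 (1 / c)\<close> and \<open>l = sqrt L\<close> this is the tangent at \<open>c\<close>, hence
concavity.  The proof is elementary: \<open>sqrt t \<le> (t + l^2) / (2 * l)\<close>, and \<open>ln z \<le> z - 1\<close>.  The free
parameters allow rational approximations of \<open>L\<close> and \<open>l\<close>.\<close>
lemma subcube_bound_le_tangent:
  assumes "0 \<le> x" "x \<le> 1" "0 < c" "log 2 (1 / c) \<le> L" "0 < l"
  shows "subcube_bound x \<le> (x * (L + l\<^sup>2) + (c - x) / ln 2) / (2 * l)"
proof (cases "x = 0")
  case True
  then show ?thesis using assms by simp
next
  case False
  then have x: "0 < x" using assms by simp
  define M where "M = log 2 (1 / x)"
  have "0 \<le> M" using assms by (simp add: M_def log_inverse_nonneg)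
  have "2 * l * sqrt M \<le> M + l\<^sup>2"
    using \<open>0 \<le> M\<close> sum_squares_bound[of "sqrt M" l] by (simp add: algebra_simps)
  then have "2 * l * subcube_bound x \<le> x * (M + l\<^sup>2)"
    using mult_left_mono[of "2 * l * sqrt M" "M + l\<^sup>2" x] x
    by (simp add: subcube_bound_def M_def mult.left_commute mult.commute)
  moreover have "x * M \<le> x * L + (c - x) / ln 2"
  proof -
    have "M = log 2 (1 / c) + ln (c / x) / ln 2"
      using x assms by (simp add: M_def log_def ln_div diff_divide_distrib)
    also have "\<dots> \<le> L + (c / x - 1) / ln 2"
      using assms x ln_le_minus_one[of "c / x"] by (intro add_mono divide_right_mono) auto
    finally have "x * M \<le> x * (L + (c / x - 1) / ln 2)" using x by simp
    also have "\<dots> = x * L + (c - x) / ln 2" using x by (simp add: field_simps)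
    finally show ?thesis .
  qed
  ultimately have "2 * l * subcube_bound x \<le> x * (L + l\<^sup>2) + (c - x) / ln 2"
    by (simp add: algebra_simps)
  then show ?thesis using assms by (simp add: field_simps)
qed

lemma subcube_bound_ge_chord:
  assumes "0 \<le> a" "a \<le> x" "x \<le> b" "a < b" "b < 1"
    and A: "A \<le> subcube_bound a" and B: "B \<le> subcube_bound b"
  shows "A + (x - a) * ((B - A) / (b - a)) \<le> subcube_bound x"
proof (cases "x = 0")
  case True
  then show ?thesis using assms by (auto simp: subcube_bound_def)
next
  case False
  then have x: "0 < x" "x < 1" using assms by auto
  define l where "l = sqrt (log 2 (1 / x))"
  have l: "0 < l" "l\<^sup>2 = log 2 (1 / x)" using x by (auto simp: l_def)
  define g where "g = 1 / ln 2 / (2 * l)"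
  have tangent: "subcube_bound u \<le> u * l + (x - u) * g" if "0 \<le> u" "u \<le> 1" for u
    using subcube_bound_le_tangent[of u x "l\<^sup>2" l] that l x
    by (simp add: g_def field_simps power2_eq_square)
  define t where "t = (x - a) / (b - a)"
  have "t * (b - a) = x - a" using assms by (simp add: t_def)
  then have t: "x = (1 - t) * a + t * b" by (simp add: algebra_simps)
  have t01: "0 \<le> t" "t \<le> 1" using assms by (simp_all add: t_def)
  have "A + (x - a) * ((B - A) / (b - a)) = (1 - t) * A + t * B"
  proof -
    have "(x - a) * ((B - A) / (b - a)) = t * (B - A)" by (simp add: t_def)
    then show ?thesis by (simp add: algebra_simps)
  qed
  also have "\<dots> \<le> (1 - t) * (a * l + (x - a) * g) + t * (b * l + (x - b) * g)"
    using tangent[of a] tangent[of b] assms t01 by (intro add_mono mult_left_mono) auto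
  also have "\<dots> = ((1 - t) * a + t * b) * l + (x - ((1 - t) * a + t * b)) * g"
    by (simp add: algebra_simps)
  also have "\<dots> = subcube_bound x"
    using t by (simp add: subcube_bound_def l_def)
  finally show ?thesis .
qed

lemma log_2_3_bounds: "19 / 12 \<le> log 2 (3::real)" "log 2 (3::real) \<le> 317 / 200"
proof -
  have "real 19 = log 2 (2 ^ 19)" by (subst log_nat_power) auto
  also have "\<dots> \<le> log 2 (3 ^ 12)" by (subst log_le_cancel_iff) auto
  also have "\<dots> = real 12 * log 2 3" by (subst log_nat_power) auto
  finally show "19 / 12 \<le> log 2 (3::real)" by simp
  have "real 200 * log 2 3 = log 2 (3 ^ 200)" by (subst log_nat_power) auto
  also have "\<dots> \<le> log 2 (2 ^ 317)" by (subst log_le_cancel_iff) auto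
  also have "\<dots> = real 317" by (subst log_nat_power) auto
  finally show "log 2 (3::real) \<le> 317 / 200" by simp
qed

lemma log_2_powers: "log 2 4 = 2" "log 2 8 = 3" "log 2 16 = (4::real)"
  using log_pow_cancel[of 2 2] log_pow_cancel[of 2 3] log_pow_cancel[of 2 4] by simp_all

lemma subcube_bound_values:
  "subcube_bound (1/16) = 1/8" "0.2165 \<le> subcube_bound (1/8)"
  "0.2913 \<le> subcube_bound (3/16)" "0.3535 \<le> subcube_bound (1/4)"
proof -
  show "subcube_bound (1/16) = 1/8"
    using real_sqrt_unique[of 2 4] by (simp add: subcube_bound_def log_2_powers)
  have "1.7320 \<le> sqrt (3::real)" by (rule real_le_rsqrt) (simp add: power2_eq_square)
  then show "0.2165 \<le> subcube_bound (1/8)" by (simp add: subcube_bound_def log_2_powers)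
  have "1.414 \<le> sqrt (2::real)" by (rule real_le_rsqrt) (simp add: power2_eq_square)
  then show "0.3535 \<le> subcube_bound (1/4)" by (simp add: subcube_bound_def log_2_powers)
  have "log 2 (16/3) \<ge> 2.415" using log_2_3_bounds by (simp add: log_divide log_2_powers)
  moreover have "1.554 \<le> sqrt (2.415::real)" by (rule real_le_rsqrt) (simp add: power2_eq_square)
  ultimately have "1.554 \<le> sqrt (log 2 (16/3))" by (meson order_trans real_sqrt_le_mono)
  then show "0.2913 \<le> subcube_bound (3/16)" by (simp add: subcube_bound_def)
qed

lemma subcube_bound_ge_linear:
  assumes "0 \<le> x" "x \<le> 1 / 2 ^ n" "l\<^sup>2 \<le> real n"
  shows "l * x \<le> subcube_bound x"
proof (cases "x = 0")
  case False
  then have x: "0 < x" using assms by simp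
  have "real n = log 2 (2 ^ n)" by (subst log_nat_power) auto
  also have "\<dots> \<le> log 2 (1 / x)" using x assms by (subst log_le_cancel_iff) (auto simp: field_simps)
  finally have "l \<le> sqrt (log 2 (1 / x))" using assms by (intro real_le_rsqrt) auto
  then show ?thesis using x by (simp add: subcube_bound_def mult.commute)
qed simp

lemma neg_ln_upper:
  assumes "0 \<le> v" "v \<le> (3/8::real)"
  shows "- ln (1 - v) \<le> v + v\<^sup>2 / 2 + 3 / 5 * v ^ 3"
proof -
  let ?g = "\<lambda>v. v + v\<^sup>2 / 2 + 3 / 5 * v ^ 3 + ln (1 - v)"
  have "?g 0 \<le> ?g v"
  proof (rule DERIV_nonneg_imp_nondecreasing[OF assms(1)])
    fix u assume u: "0 \<le> u" "u \<le> v"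
    then have "u < 1" using assms by simp
    have "(?g has_real_derivative (1 + u + 9/5 * u\<^sup>2 - 1 / (1 - u))) (at u)"
      using \<open>u < 1\<close> by (auto intro!: derivative_eq_intros)
    moreover have "1 + u + 9/5 * u\<^sup>2 - 1 / (1 - u) = u\<^sup>2 * (4/5 - 9/5 * u) / (1 - u)"
      using \<open>u < 1\<close> by (simp add: field_simps power2_eq_square)
    moreover have "\<dots> \<ge> 0" using u assms \<open>u < 1\<close> by (intro divide_nonneg_pos mult_nonneg_nonneg) auto
    ultimately show "\<exists>y. (?g has_real_derivative y) (at u) \<and> 0 \<le> y" by (intro exI conjI) auto
  qed
  then show ?thesis by simp
qed

lemma neg_ln_lower:
  assumes "0 \<le> v" "v < (1::real)"
  shows "v + v\<^sup>2 / 2 + v ^ 3 / 3 \<le> - ln (1 - v)"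
proof -
  let ?g = "\<lambda>v. - ln (1 - v) - v - v\<^sup>2 / 2 - v ^ 3 / 3"
  have "?g 0 \<le> ?g v"
  proof (rule DERIV_nonneg_imp_nondecreasing[OF assms(1)])
    fix u assume u: "0 \<le> u" "u \<le> v"
    then have "u < 1" using assms by simp
    have "(?g has_real_derivative (1 / (1 - u) - 1 - u - u\<^sup>2)) (at u)"
      using \<open>u < 1\<close> by (auto intro!: derivative_eq_intros)
    moreover have "1 / (1 - u) - 1 - u - u\<^sup>2 = u ^ 3 / (1 - u)"
      using \<open>u < 1\<close> by (simp add: field_simps power2_eq_square power3_eq_cube)
    moreover have "\<dots> \<ge> 0" using u \<open>u < 1\<close> by simp
    ultimately show "\<exists>y. (?g has_real_derivative y) (at u) \<and> 0 \<le> y" by (intro exI conjI) auto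
  qed
  then show ?thesis by simp
qed

section \<open>The two-point inequality for the subcube bound\<close>

text \<open>The inequality of \<open>rescaled_entropy_ineq\<close> with 2 in place of \<open>q\<close> and the bound
\<open>1 - 1.28 * r\<close> in place of \<open>w\<close>.\<close>
lemma rescaled_poly_small:
  assumes "0 \<le> r" "r \<le> (1/4::real)"
  defines "p \<equiv> (1 - r)\<^sup>2"
  shows "(1 + r)\<^sup>2 * (1 - 1.28 * r) * (p + 4) \<le> (p + 2 * r\<^sup>2) * (p + 4) + 2 * r * (5 * p + 2)"
proof -
  have "0 \<le> pval (let r = Mul (Frac 1 4) Vs; p = Sq (Sub (Num 1) r) in
      Sub (Add (Mul (Add p (Mul (Num 2) (Sq r))) (Add p (Num 4)))
               (Mul (Mul (Num 2) r) (Add (Mul (Num 5) p) (Num 2))))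
          (Mul (Mul (Sq (Add (Num 1) r)) (Sub (Num 1) (Mul (Frac 128 100) r))) (Add p (Num 4))))
      (4 * r) 0"
    by (rule pval_nonneg[of "[]"], code_simp) (use assms in auto)
  then show ?thesis by (simp add: p_def power2_eq_square Let_def)
qed

text \<open>Here \<open>e\<close> stands for \<open>1 - r\<close>, the logarithms in \<open>rescaled_entropy_ineq\<close> are replaced by Taylor
polynomials, and \<open>m\<close> ranges over an interval around \<open>1 / ln 2\<close>.  The difference of the two sides vanishes
to second order at \<open>e = 0\<close> for every \<open>m\<close>, because the same \<open>m\<close> occurs in \<open>q\<close> and \<open>w\<close>.\<close>
lemma rescaled_poly_large:
  assumes "0 \<le> e" "e \<le> (3/4::real)" "1.44 \<le> m" "m \<le> 1.45"
  defines "r \<equiv> 1 - e" and "p \<equiv> e\<^sup>2" and "q \<equiv> m * (e + e\<^sup>2 / 2 + e ^ 3 / 3)"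
    and "w \<equiv> m * (e / 2 + (e / 2)\<^sup>2 / 2 + 3 / 5 * (e / 2) ^ 3)"
  shows "(1 + r)\<^sup>2 * w * (2 + p + q) \<le> (p + r\<^sup>2 * q) * (2 + p + q) + 2 * r * (p + q + 2 * p * q)"
proof -
  have "0 \<le> pval (let e = Mul (Frac 3 4) Vs; m = Add (Frac 144 100) (Mul (Frac 1 100) Vt);
      r = Sub (Num 1) e; p = Sq e; h = Mul (Frac 1 2) e;
      q = Mul m (Add e (Add (Mul (Frac 1 2) (Sq e)) (Mul (Frac 1 3) (Mul e (Sq e)))));
      w = Mul m (Add h (Add (Mul (Frac 1 2) (Sq h)) (Mul (Frac 3 5) (Mul h (Sq h)))));
      u = Add (Num 2) (Add p q) in
      Sub (Add (Mul (Add p (Mul (Sq r) q)) u)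
               (Mul (Mul (Num 2) r) (Add p (Add q (Mul (Num 2) (Mul p q))))))
          (Mul (Mul (Sq (Add (Num 1) r)) w) u))
      (4 / 3 * e) (100 * m - 144)"
    by (rule pval_nonneg[of "[]"], code_simp) (use assms in auto)
  moreover have "36 / 25 + (100 * m - 144) / 100 = m" by (simp add: field_simps)
  ultimately show ?thesis
    by (simp add: p_def q_def w_def r_def power2_eq_square power3_eq_cube Let_def mult.assoc add.assoc)
qed

lemma mediant_mono:
  fixes p q q' :: real
  assumes "0 \<le> p" "0 \<le> q" "q \<le> q'"
  shows "(p + q + 2 * p * q) / (2 + p + q) \<le> (p + q' + 2 * p * q') / (2 + p + q')"
proof -
  have "0 \<le> (q' - q) * (2 + 4 * p + 2 * p * p)" using assms by (intro mult_nonneg_nonneg) auto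
  then have "(p + q + 2 * p * q) * (2 + p + q') \<le> (p + q' + 2 * p * q') * (2 + p + q)"
    by (simp add: algebra_simps)
  then show ?thesis using assms by (simp add: frac_le_eq divide_le_eq pos_le_divide_eq)
qed

text \<open>The case \<open>l = 1\<close> of \<open>rescaled_two_point\<close> after squaring, with the geometric mean replaced by the
harmonic mean to remove the square root.  For small \<open>r\<close> crude bounds on the logarithms suffice; near \<open>r = 1\<close> both sides agree to first order, which asks for
Taylor polynomials.\<close>
lemma rescaled_entropy_ineq:
  fixes r :: real
  assumes "0 < r" "r \<le> 1"
  defines "p \<equiv> (1 - r)\<^sup>2" and "q \<equiv> log 2 (1 / r)" and "w \<equiv> log 2 (2 / (1 + r))"
  shows "(1 + r)\<^sup>2 * w \<le> p + r\<^sup>2 * q + 2 * r * ((p + q + 2 * p * q) / (2 + p + q))"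
proof -
  have q_ln: "q = - ln r / ln 2" using assms by (simp add: q_def log_def ln_div)
  have w_ln: "w = 1 - ln (1 + r) / ln 2" using assms by (simp add: w_def log_def ln_div diff_divide_distrib)
  have p: "0 \<le> p" by (simp add: p_def)
  note m = inverse_ln2_bounds
  \<comment> \<open>The left side increases in \<open>w\<close> and the right side in \<open>q\<close>.\<close>
  have reduce: ?thesis if "(1 + r)\<^sup>2 * w' * (2 + p + q') \<le>
      (p + r\<^sup>2 * q') * (2 + p + q') + 2 * r * (p + q' + 2 * p * q')"
    and "0 \<le> q'" "q' \<le> q" "w \<le> w'" for q' w'
  proof -
    have pos: "0 < 2 + p + q'" using p that by simp
    have "(1 + r)\<^sup>2 * w \<le> (1 + r)\<^sup>2 * w'" using that by (intro mult_left_mono) auto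
    also have "\<dots> = (1 + r)\<^sup>2 * w' * (2 + p + q') / (2 + p + q')" using pos by simp
    also have "\<dots> \<le> ((p + r\<^sup>2 * q') * (2 + p + q') + 2 * r * (p + q' + 2 * p * q')) / (2 + p + q')"
      using that pos by (intro divide_right_mono) auto
    also have "\<dots> = p + r\<^sup>2 * q' + 2 * r * ((p + q' + 2 * p * q') / (2 + p + q'))"
      using pos by (subst add_divide_distrib) simp
    also have "\<dots> \<le> p + r\<^sup>2 * q + 2 * r * ((p + q + 2 * p * q) / (2 + p + q))"
      using that assms p by (intro add_mono mult_left_mono mediant_mono) auto
    finally show ?thesis .
  qed
  show ?thesis
  proof (cases "r \<le> 1/4")
    case True
    have "2 \<le> q"
    proof -
      have "log 2 4 \<le> log 2 (1 / r)" using assms True by (subst log_le_cancel_iff) (auto simp: field_simps)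
      then show ?thesis by (simp add: q_def log_2_powers)
    qed
    moreover have "w \<le> 1 - 1.28 * r"
    proof -
      have "1.28 * r \<le> 1.44 * (2 * r / (2 + r))"
      proof -
        have "r * (2 + r) \<le> r * (9/4)" using True assms by (intro mult_left_mono) auto
        then show ?thesis using assms by (simp add: field_simps)
      qed
      also have "\<dots> \<le> 1 / ln 2 * ln (1 + r)"
        using ln_inverse_approx_ge[of 1 "1 + r"] m assms by (intro mult_mono) auto
      finally show ?thesis by (simp add: w_ln)
    qed
    ultimately show ?thesis
      using rescaled_poly_small[of r] True assms(1)
      by (intro reduce[of "1 - 1.28 * r" 2]) (auto simp: p_def algebra_simps)
  next
    case False
    define e where "e = 1 - r"
    have e: "0 \<le> e" "e \<le> 3/4" "r = 1 - e" "p = e\<^sup>2" using False assms by (auto simp: e_def p_def)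
    have q: "1 / ln 2 * (e + e\<^sup>2 / 2 + e ^ 3 / 3) \<le> q"
      using mult_left_mono[OF neg_ln_lower[of e], of "1 / ln 2"] e m by (simp add: q_ln)
    have "ln (1 + r) = ln 2 + ln (1 - e / 2)"
    proof -
      have "1 + r = 2 * (1 - e / 2)" by (simp add: e_def field_simps)
      moreover have "ln (2 * (1 - e / 2)) = ln 2 + ln (1 - e / 2)" using e by (intro ln_mult_pos) auto
      ultimately show ?thesis by (simp only:)
    qed
    then have "w = 1 / ln 2 * (- ln (1 - e / 2))" by (simp add: w_ln field_simps)
    then have w: "w \<le> 1 / ln 2 * (e / 2 + (e / 2)\<^sup>2 / 2 + 3 / 5 * (e / 2) ^ 3)"
      using mult_left_mono[OF neg_ln_upper[of "e / 2"], of "1 / ln 2"] e by simp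
    have r: "1 - e = r" by (simp add: e_def)
    show ?thesis
    proof (rule reduce[OF _ _ q w])
      show "0 \<le> 1 / ln 2 * (e + e\<^sup>2 / 2 + e ^ 3 / 3)" using e by simp
    qed (use rescaled_poly_large[of e "1 / ln 2"] e(1,2) m in \<open>simp only: r e(4)\<close>)
  qed
qed

lemma harmonic_le_sqrt_mult:
  fixes a b :: real
  assumes "0 < a" "0 < b"
  shows "2 * a * b / (a + b) \<le> sqrt (a * b)"
proof (rule real_le_rsqrt)
  have "4 * (a * b) \<le> (a + b)\<^sup>2" using sum_squares_bound[of a b] by (simp add: power2_eq_square algebra_simps)
  then have "(a * b) * (4 * (a * b)) \<le> (a * b) * (a + b)\<^sup>2" using assms by (intro mult_left_mono) auto
  moreover have "(a * b) * (4 * (a * b)) = (2 * a * b)\<^sup>2" by (simp add: power2_eq_square)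
  ultimately have "(2 * a * b)\<^sup>2 \<le> (a * b) * (a + b)\<^sup>2" by simp
  then show "(2 * a * b / (a + b))\<^sup>2 \<le> a * b"
    using assms by (simp add: power_divide pos_divide_le_eq del: power_mult_distrib)
qed

text \<open>After squaring, \<open>l\<close> enters the difference of the two sides only through
\<open>sqrt ((l + p) * (l + q)) - l\<close>.  This is increasing in \<open>l\<close>, and so is its harmonic lower bound; the
worst case is \<open>l = 1\<close>, that is, a larger section of measure 1/2.\<close>
lemma rescaled_two_point:
  fixes r l :: real
  assumes "0 < r" "r \<le> 1" "1 \<le> l"
  shows "(1 + r) * sqrt (l + log 2 (2 / (1 + r)))
    \<le> sqrt (l + (1 - r)\<^sup>2) + r * sqrt (l + log 2 (1 / r))"
proof -
  define p q w where "p = (1 - r)\<^sup>2" and "q = log 2 (1 / r)" and "w = log 2 (2 / (1 + r))"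
  have p: "0 \<le> p" by (simp add: p_def)
  have q: "0 \<le> q" using assms by (simp add: q_def)
  have w: "0 \<le> w" using assms by (simp add: w_def)
  have "l + (p + q + 2 * p * q) / (2 + p + q) \<le> l + ((p + q) * l + 2 * p * q) / (2 * l + p + q)"
  proof -
    have "0 \<le> (l - 1) * (p - q)\<^sup>2" using assms by simp
    then have "(p + q + 2 * p * q) * (2 * l + p + q) \<le> ((p + q) * l + 2 * p * q) * (2 + p + q)"
      by (simp add: power2_eq_square algebra_simps)
    then show ?thesis using p q assms by (simp add: divide_le_eq pos_le_divide_eq)
  qed
  also have "\<dots> = 2 * (l + p) * (l + q) / ((l + p) + (l + q))"
    using p q assms by (simp add: field_simps)
  also have "\<dots> \<le> sqrt ((l + p) * (l + q))"
    using p q assms by (intro harmonic_le_sqrt_mult) auto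
  finally have gm: "l + (p + q + 2 * p * q) / (2 + p + q) \<le> sqrt (l + p) * sqrt (l + q)"
    by (simp add: real_sqrt_mult)
  have "((1 + r) * sqrt (l + w))\<^sup>2 = (1 + r)\<^sup>2 * l + (1 + r)\<^sup>2 * w"
    using w assms by (simp add: power_mult_distrib flip: distrib_left)
  also have "\<dots> \<le> (1 + r)\<^sup>2 * l + (p + r\<^sup>2 * q + 2 * r * ((p + q + 2 * p * q) / (2 + p + q)))"
    using rescaled_entropy_ineq[of r] assms by (simp add: p_def q_def w_def)
  also have "\<dots> = (l + p) + r\<^sup>2 * (l + q) + 2 * r * (l + (p + q + 2 * p * q) / (2 + p + q))"
    by (simp add: power2_eq_square algebra_simps)
  also have "\<dots> \<le> (l + p) + r\<^sup>2 * (l + q) + 2 * r * (sqrt (l + p) * sqrt (l + q))"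
    using gm assms by (intro add_left_mono mult_left_mono) auto
  also have "\<dots> = (sqrt (l + p) + r * sqrt (l + q))\<^sup>2"
    using p q assms by (simp add: power2_sum power_mult_distrib)
  finally show ?thesis
    unfolding p_def q_def w_def by (rule power2_le_imp_le) (use assms in auto)
qed

text \<open>The substitution \<open>x = r * y\<close>, \<open>l = log 2 (1 / y)\<close> takes \<open>y\<close> out as a common factor.\<close>
lemma subcube_bound_two_point:
  assumes "0 \<le> x" "x \<le> y" "y \<le> 1 / 2"
  shows "2 * subcube_bound ((x + y) / 2) \<le> sqrt ((y - x)\<^sup>2 + (subcube_bound y)\<^sup>2) + subcube_bound x"
proof (cases "y = 0")
  case True
  then show ?thesis using assms by simp
next
  case False
  then have y: "0 < y" using assms by simp
  define l where "l = log 2 (1 / y)"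
  have "log 2 2 \<le> log 2 (1 / y)" using y assms by (subst log_le_cancel_iff) (auto simp: field_simps)
  then have l: "1 \<le> l" by (simp add: l_def)
  define r where "r = x / y"
  have r: "0 \<le> r" "r \<le> 1" "x = r * y" using assms y by (auto simp: r_def)
  have "2 * subcube_bound ((x + y) / 2) = y * ((1 + r) * sqrt (l + log 2 (2 / (1 + r))))"
  proof -
    have "2 / (x + y) = (1 / y) * (2 / (1 + r))" using y r by (simp add: field_simps)
    then have "log 2 (2 / (x + y)) = l + log 2 (2 / (1 + r))"
      using y r by (simp only: l_def, subst log_mult) auto
    then show ?thesis using r by (simp add: subcube_bound_def algebra_simps)
  qed
  moreover have "sqrt ((y - x)\<^sup>2 + (subcube_bound y)\<^sup>2) = y * sqrt (l + (1 - r)\<^sup>2)"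
  proof -
    have "(y - x)\<^sup>2 + (subcube_bound y)\<^sup>2 = y\<^sup>2 * (l + (1 - r)\<^sup>2)"
      using l r by (simp add: subcube_bound_def l_def[symmetric] power_mult_distrib)
        (simp add: power2_eq_square algebra_simps)
    then show ?thesis using y by (simp add: real_sqrt_mult)
  qed
  moreover have "(1 + r) * sqrt (l + log 2 (2 / (1 + r)))
      \<le> sqrt (l + (1 - r)\<^sup>2) + r * sqrt (l + log 2 (1 / r))"
    using rescaled_two_point[of r l] r l by (cases "r = 0") auto
  moreover have "subcube_bound x = y * (r * sqrt (l + log 2 (1 / r)))"
  proof (cases "r = 0")
    case False
    then have "log 2 (1 / x) = l + log 2 (1 / r)"
      using y r by (simp add: l_def log_mult log_divide)
    then show ?thesis using r by (simp add: subcube_bound_def)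
  qed (use r in simp)
  ultimately show ?thesis using y
    by (metis (no_types, lifting) distrib_left mult_le_cancel_left_pos)
qed

section \<open>Polynomial inequalities for the profile\<close>

text \<open>The constants satisfy \<open>cap (1/2) = 1/2\<close>, and \<open>cap (1/4)\<close> is just below the value
\<open>sqrt 2 / 4\<close> of \<open>subcube_bound\<close>.\<close>
definition cap :: "real \<Rightarrow> real" where
  "cap x = 0.50284624 - 1.7789 * (x - 0.54)\<^sup>2"

definition cap_exp :: "pexp \<Rightarrow> pexp" where
  "cap_exp X = Sub (Frac 50284624 100000000) (Mul (Frac 17789 10000) (Sq (Sub X (Frac 54 100))))"

lemma pval_cap_exp [simp]: "pval (cap_exp X) s t = cap (pval X s t)"
  by (simp add: cap_exp_def cap_def power2_eq_square)

definition between :: "pexp \<Rightarrow> pexp \<Rightarrow> pexp \<Rightarrow> pexp" where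
  "between A B Z = Add A (Mul (Sub B A) Z)"

lemma between_param:
  assumes "x \<in> closed_segment a (b::real)"
  obtains s where "0 \<le> s" "s \<le> 1" "a + (b - a) * s = x"
  using assms by (auto simp: in_segment algebra_simps)

text \<open>The test of \<open>(2 * cap ((x + y) / 2) - l x)^2 \<le> r x y\<close> for \<open>x\<close> between \<open>A\<close> and \<open>B\<close> and
\<open>y\<close> between \<open>lo x\<close> and \<open>hi x\<close>.  In the applications \<open>l\<close> is a lower bound for
\<open>profile x\<close>, and \<open>r\<close> one for the expression under the root in the two-point inequality.\<close>
definition cap_check :: "bool list \<Rightarrow> pexp \<Rightarrow> pexp \<Rightarrow> (pexp \<Rightarrow> pexp) \<Rightarrow> (pexp \<Rightarrow> pexp)
    \<Rightarrow> (pexp \<Rightarrow> pexp) \<Rightarrow> (pexp \<Rightarrow> pexp \<Rightarrow> pexp) \<Rightarrow> bool" where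
  "cap_check ds A B lo hi l r = (let X = between A B Vs; Y = between (lo X) (hi X) Vt in
     nonneg_on_square ds
       (Sub (r X Y) (Sq (Sub (Mul (Num 2) (cap_exp (Mul (Frac 1 2) (Add X Y)))) (l X)))))"

text \<open>The assumptions \<open>const\<close> say that \<open>A\<close> and \<open>B\<close> are constants and that \<open>lo\<close> and
\<open>hi\<close> introduce no dependence on the second variable.\<close>
lemma cap_check_sound:
  assumes chk: "cap_check ds A B lo hi l r"
    and x: "\<And>s t. x \<in> closed_segment (pval A s t) (pval B s t)"
    and y: "\<And>X s t. pval X s t = x \<Longrightarrow> y \<in> closed_segment (pval (lo X) s t) (pval (hi X) s t)"
    and const: "\<And>s t. pval A s t = pval A 0 0" "\<And>s t. pval B s t = pval B 0 0"
      "\<And>X s t. pval X s t = pval X s 0 \<Longrightarrow> pval (lo X) s t = pval (lo X) s 0"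
      "\<And>X s t. pval X s t = pval X s 0 \<Longrightarrow> pval (hi X) s t = pval (hi X) s 0"
  obtains X Y s t where "pval X s t = x" "pval Y s t = y"
    "(2 * cap ((x + y) / 2) - pval (l X) s t)\<^sup>2 \<le> pval (r X Y) s t"
proof -
  obtain s where s: "0 \<le> s" "s \<le> 1" "pval A 0 0 + (pval B 0 0 - pval A 0 0) * s = x"
    by (rule between_param[OF x[of 0 0]])
  define X where "X = between A B Vs"
  have X: "pval X s t = x" for t
    unfolding X_def between_def pval.simps const(1)[of s t] const(2)[of s t] by (rule s(3))
  obtain t where t: "0 \<le> t" "t \<le> 1"
    "pval (lo X) s 0 + (pval (hi X) s 0 - pval (lo X) s 0) * t = y"
    by (rule between_param[OF y[OF X[of 0]]])
  define Y where "Y = between (lo X) (hi X) Vt"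
  have lo: "pval (lo X) s t = pval (lo X) s 0" by (rule const(3)) (simp only: X[of t] X[of 0])
  have hi: "pval (hi X) s t = pval (hi X) s 0" by (rule const(4)) (simp only: X[of t] X[of 0])
  have Y: "pval Y s t = y"
    unfolding Y_def between_def pval.simps lo hi by (rule t(3))
  have "nonneg_on_square ds
      (Sub (r X Y) (Sq (Sub (Mul (Num 2) (cap_exp (Mul (Frac 1 2) (Add X Y)))) (l X))))"
    using chk by (simp add: cap_check_def Let_def X_def Y_def)
  then have "0 \<le> pval
      (Sub (r X Y) (Sq (Sub (Mul (Num 2) (cap_exp (Mul (Frac 1 2) (Add X Y)))) (l X)))) s t"
    using s(1,2) t(1,2) by (rule pval_nonneg)
  then have "(2 * cap ((x + y) / 2) - pval (l X) s t)\<^sup>2 \<le> pval (r X Y) s t"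
    by (simp add: X Y power2_eq_square)
  then show ?thesis using X Y by (intro that)
qed

text \<open>The chords of \<open>subcube_bound\<close> with the nodes 0, 1/16, 1/8, 3/16 and 1/4, with values rounded down, followed by
lower bounds for the expression under the root in the two-point inequality.  They use the square of \<open>cap y\<close>, a
lower bound for the square of \<open>tail y\<close> (\<open>tail_square_ge_quadratic\<close>), and the linear pieces of the
edge bound.\<close>
abbreviation "chord1 X \<equiv> Mul (Num 2) X"
abbreviation "chord2 X \<equiv> Add (Frac 125 1000) (Mul (Frac 1464 1000) (Sub X (Frac 1 16)))"
abbreviation "chord3 X \<equiv> Add (Frac 2165 10000) (Mul (Frac 11968 10000) (Sub X (Frac 1 8)))"
abbreviation "chord4 X \<equiv> Add (Frac 2913 10000) (Mul (Frac 9952 10000) (Sub X (Frac 3 16)))"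
abbreviation "via_cap X Y \<equiv> Add (Sq (Sub Y X)) (Sq (cap_exp Y))"
abbreviation "via_tail X Y \<equiv> Add (Sq (Sub Y X)) (Sub (Sq (Frac 50284624 100000000))
  (Mul (Mul (Num 2) (Frac 50284624 100000000)) (Mul (Frac 198494 100000) (Sq (Sub Y (Frac 54 100))))))"
abbreviation "via_edge E X Y \<equiv> Add (Sq (Sub Y X)) (Mul (Sub Y X) (E Y))"
abbreviation "edge2 Y \<equiv> Sub (Frac 5 4) Y"
abbreviation "edge3 Y \<equiv> Sub (Num 3) (Mul (Num 3) Y)"
abbreviation "half_minus X \<equiv> Sub (Frac 1 2) X"

abbreviation "bisect \<equiv> [True, False, True, False, True, False, True, False, True, False]"

text \<open>Near \<open>x = 0\<close>, \<open>y = 1\<close> the two sides tend to each other.  The last rectangle is therefore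
parametrized from \<open>y = 1\<close> downwards, so that this corner becomes the origin: the constant coefficient is 0 there and the
linear ones are positive, which the Horner bound can use.\<close>
lemma cap_checks_chord1:
  "cap_check [] (Num 0) (Frac 1 16) half_minus (\<lambda>X. Add (Frac 1 2) (Mul (Frac 1 2) X)) (\<lambda>X. chord1 X) (\<lambda>X Y. via_cap X Y)"
  "cap_check [] (Num 0) (Frac 1 16) (\<lambda>X. Add (Frac 1 2) (Mul (Frac 1 2) X)) (\<lambda>X. Frac 5 8) (\<lambda>X. chord1 X) (\<lambda>X Y. via_edge (\<lambda>Y. Y) X Y)"
  "cap_check [] (Num 0) (Frac 1 16) (\<lambda>X. Frac 5 8) (\<lambda>X. Frac 7 8) (\<lambda>X. chord1 X) (\<lambda>X Y. via_edge (\<lambda>Y. edge2 Y) X Y)"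
  "cap_check [] (Num 0) (Frac 1 16) (\<lambda>X. Num 1) (\<lambda>X. Frac 7 8) (\<lambda>X. chord1 X) (\<lambda>X Y. via_edge (\<lambda>Y. edge3 Y) X Y)"
  by code_simp+

lemma cap_checks_chord2:
  "cap_check [] (Frac 1 16) (Frac 1 8) half_minus (\<lambda>X. Frac 54 100) (\<lambda>X. chord2 X) (\<lambda>X Y. via_cap X Y)"
  "cap_check [] (Frac 1 16) (Frac 1 8) (\<lambda>X. Frac 54 100) (\<lambda>X. Frac 57 100) (\<lambda>X. chord2 X) (\<lambda>X Y. via_tail X Y)"
  "cap_check [] (Frac 1 16) (Frac 1 8) (\<lambda>X. Frac 57 100) (\<lambda>X. Frac 5 8) (\<lambda>X. chord2 X) (\<lambda>X Y. via_edge (\<lambda>Y. Y) X Y)"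
  "cap_check [] (Frac 1 16) (Frac 1 8) (\<lambda>X. Frac 5 8) (\<lambda>X. Frac 7 8) (\<lambda>X. chord2 X) (\<lambda>X Y. via_edge (\<lambda>Y. edge2 Y) X Y)"
  "cap_check [] (Frac 1 16) (Frac 1 8) (\<lambda>X. Frac 7 8) (\<lambda>X. Num 1) (\<lambda>X. chord2 X) (\<lambda>X Y. via_edge (\<lambda>Y. edge3 Y) X Y)"
  by code_simp+

lemma cap_checks_chord3:
  "cap_check bisect (Frac 1 8) (Frac 3 16) half_minus (\<lambda>X. Frac 54 100) (\<lambda>X. chord3 X) (\<lambda>X Y. via_cap X Y)"
  "cap_check bisect (Frac 1 8) (Frac 3 16) (\<lambda>X. Frac 54 100) (\<lambda>X. Frac 5 8) (\<lambda>X. chord3 X) (\<lambda>X Y. via_tail X Y)"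
  "cap_check [] (Frac 1 8) (Frac 3 16) (\<lambda>X. Frac 5 8) (\<lambda>X. Frac 7 8) (\<lambda>X. chord3 X) (\<lambda>X Y. via_edge (\<lambda>Y. edge2 Y) X Y)"
  "cap_check [] (Frac 1 8) (Frac 3 16) (\<lambda>X. Frac 7 8) (\<lambda>X. Num 1) (\<lambda>X. chord3 X) (\<lambda>X Y. via_edge (\<lambda>Y. edge3 Y) X Y)"
  by code_simp+

lemma cap_checks_chord4:
  "cap_check bisect (Frac 3 16) (Frac 1 4) (\<lambda>X. Frac 54 100) (\<lambda>X. Frac 64 100) (\<lambda>X. chord4 X) (\<lambda>X Y. via_tail X Y)"
  "cap_check bisect (Frac 3 16) (Frac 1 4) (\<lambda>X. Frac 64 100) (\<lambda>X. Frac 7 8) (\<lambda>X. chord4 X) (\<lambda>X Y. via_edge (\<lambda>Y. edge2 Y) X Y)"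
  "cap_check [] (Frac 3 16) (Frac 1 4) (\<lambda>X. Frac 7 8) (\<lambda>X. Num 1) (\<lambda>X. chord4 X) (\<lambda>X Y. via_edge (\<lambda>Y. edge3 Y) X Y)"
  by code_simp+

text \<open>The last summand carries a multiplier for the constraint that
\<open>z^2 + 2 * z * w - w^2\<close> exceeds 0.1333; without the constraint the difference of the first two terms may be
negative.\<close>
lemma cap_edge_poly:
  assumes "0.1 \<le> w" "w \<le> 0.29" "0.25 \<le> z" "z \<le> (0.29::real)"
  shows "0 \<le> (w + z) * (z + 0.71) - (0.50284624 + 0.88945 * (z\<^sup>2 + 2 * z * w - w\<^sup>2))\<^sup>2
    - 0.6 * (z\<^sup>2 + 2 * z * w - w\<^sup>2 - 0.1333)"
proof -
  obtain s where s: "0 \<le> s" "s \<le> 1" "0.1 + (0.29 - 0.1) * s = w"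
    by (rule between_param[of w "0.1" "0.29"]) (use assms in \<open>auto simp: closed_segment_eq_real_ivl\<close>)
  obtain t where t: "0 \<le> t" "t \<le> 1" "0.25 + (0.29 - 0.25) * t = z"
    by (rule between_param[of z "0.25" "0.29"]) (use assms in \<open>auto simp: closed_segment_eq_real_ivl\<close>)
  have "0 \<le> pval (let w = Add (Frac 1 10) (Mul (Frac 19 100) Vs); z = Add (Frac 1 4) (Mul (Frac 1 25) Vt);
      g = Sub (Add (Sq z) (Mul (Num 2) (Mul z w))) (Sq w) in
      Sub (Sub (Mul (Add w z) (Add z (Frac 71 100)))
          (Sq (Add (Frac 50284624 100000000) (Mul (Frac 88945 100000) g))))
        (Mul (Frac 6 10) (Sub g (Frac 1333 10000)))) s t"
    by (rule pval_nonneg[of "[]"], code_simp) (use s t in auto)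
  moreover have "1 / 10 + 19 * s / 100 = w" "1 / 4 + t / 25 = z" using s(3) t(3) by simp_all
  ultimately show ?thesis by (simp add: Let_def power2_eq_square mult.assoc)
qed

text \<open>Here \<open>y = 0.54 + w\<close>, \<open>x = 0.54 - z\<close>, and \<open>0.99247 = 1.98494 / 2\<close>; see \<open>two_point_tail\<close>.\<close>
lemma cap_tail_poly:
  assumes "0 \<le> z" "z \<le> w" "w \<le> (0.46::real)"
  shows "(0.50284624 - 0.99247 * (w - z)\<^sup>2 + 1.7789 * z\<^sup>2)\<^sup>2
    \<le> 0.50284624\<^sup>2 - 2 * 0.50284624 * 1.98494 * w\<^sup>2 + 2.6327 * (w\<^sup>2)\<^sup>2 + (w + z)\<^sup>2"
proof -
  obtain s where s: "0 \<le> s" "s \<le> 1" "0 + (0.46 - 0) * s = w"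
    by (rule between_param[of w 0 "0.46"]) (use assms in \<open>auto simp: closed_segment_eq_real_ivl\<close>)
  obtain t where t: "0 \<le> t" "t \<le> 1" "0 + (w - 0) * t = z"
    by (rule between_param[of z 0 w]) (use assms in \<open>auto simp: closed_segment_eq_real_ivl\<close>)
  have "0 \<le> pval (let w = Mul (Frac 46 100) Vs; z = Mul w Vt in
      Sub (Add (Add (Sub (Sq (Frac 50284624 100000000))
          (Mul (Mul (Num 2) (Mul (Frac 50284624 100000000) (Frac 198494 100000))) (Sq w)))
            (Mul (Frac 26327 10000) (Sq (Sq w)))) (Sq (Add w z)))
        (Sq (Add (Sub (Frac 50284624 100000000) (Mul (Frac 99247 100000) (Sq (Sub w z))))
            (Mul (Frac 17789 10000) (Sq z))))) s t"
    by (rule pval_nonneg[of "[False, False, False, False, False]"], code_simp) (use s t in auto)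
  moreover have "23 * s / 50 = w" "w * t = z" using s(3) t(3) by simp_all
  ultimately show ?thesis by (simp add: Let_def power2_eq_square mult.assoc)
qed

text \<open>This is \<open>tail * tail'' \<ge> -2\<close> in the variable \<open>W = (x - 0.54)^2\<close>.\<close>
lemma tail_ode_poly:
  assumes "0 \<le> W" "W \<le> (0.2116::real)"
  shows "(2 * 1.98494 + 12 * 1.29984 * W + 30 * 2.6 * W\<^sup>2)
    * (0.50284624 - 1.98494 * W - 1.29984 * W\<^sup>2 - 2.6 * W ^ 3) \<le> 2"
proof -
  obtain s where s: "0 \<le> s" "s \<le> 1" "0 + (0.2116 - 0) * s = W"
    by (rule between_param[of W 0 "0.2116"]) (use assms in \<open>auto simp: closed_segment_eq_real_ivl\<close>)
  have "0 \<le> pval (let W = Mul (Frac 2116 10000) Vs in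
      Sub (Num 2) (Mul (Add (Frac 396988 100000) (Add (Mul (Frac 1559808 100000) W) (Mul (Num 78) (Sq W))))
        (Sub (Frac 50284624 100000000) (Add (Mul (Frac 198494 100000) W)
          (Add (Mul (Frac 129984 100000) (Sq W)) (Mul (Frac 26 10) (Mul W (Sq W)))))))) s 0"
    by (rule pval_nonneg[of "[True, True, True, True, True, True]"], code_simp) (use s in auto)
  moreover have "529 * s / 2500 = W" using s(3) by simp
  ultimately show ?thesis
    by (simp add: Let_def power2_eq_square power3_eq_cube mult.assoc diff_diff_eq add.assoc)
qed

section \<open>The profile\<close>

text \<open>The number 0.2116 is the square of \<open>1 - 0.54\<close>, and 0.50284624 = 2.3764 * 0.2116 (see
\<open>tail_factor\<close>): the polynomial starts at the top of \<open>cap\<close> and vanishes at 1.  The other coefficients are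
chosen close to the solution of \<open>B * B'' = -2\<close>.\<close>
definition tail :: "real \<Rightarrow> real" where
  "tail x = 0.50284624 - 1.98494 * (x - 0.54) ^ 2 - 1.29984 * (x - 0.54) ^ 4 - 2.6 * (x - 0.54) ^ 6"

text \<open>The maximum makes the switch from \<open>subcube_bound\<close> to \<open>cap\<close> a convex kink: at a midpoint, the
two-point inequality is needed only for the function that is active there.\<close>
definition profile :: "real \<Rightarrow> real" where
  "profile x = (if x < 1/4 then subcube_bound x
     else if x \<le> 1/2 then max (subcube_bound x) (cap x)
     else if x \<le> 0.54 then cap x else tail x)"

text \<open>The linear interpolation of the minimal normalized edge boundary, with the nodes at the multiples of 1/4 up to
1/2 and at 5/8, 7/8 and 1.\<close>
definition edge_bound :: "real \<Rightarrow> real" where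
  "edge_bound a = (if a \<le> 1/2 then min (2 * a) (1/2) else min a (min (5/4 - a) (3 - 3 * a)))"

lemma edge_bound_cases:
  "edge_bound a = 2 * a \<and> a \<le> 1/4 \<or> edge_bound a = 1/2 \<and> 1/4 \<le> a \<and> a \<le> 1/2 \<or>
   edge_bound a = a \<and> 1/2 \<le> a \<and> a \<le> 5/8 \<or> edge_bound a = 5/4 - a \<and> 5/8 \<le> a \<and> a \<le> 7/8 \<or>
   edge_bound a = 3 - 3 * a \<and> 7/8 \<le> a"
  unfolding edge_bound_def min_def by (simp; linarith)

lemma edge_bound_two_point:
  assumes "0 \<le> x" "x \<le> y" "y \<le> 1"
  shows "2 * edge_bound ((x + y) / 2) \<le> edge_bound x + edge_bound y + (y - x)"
proof -
  have *: "2 * edge_bound c \<le> edge_bound x + edge_bound y + (y - x)" if c: "2 * c = x + y" for c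
    using edge_bound_cases[of x] edge_bound_cases[of y] edge_bound_cases[of c]
    by (elim disjE conjE) (use assms c in linarith)+
  show ?thesis by (rule *) simp
qed

lemma edge_bound_ends: "edge_bound 0 = 0" "edge_bound 1 = 0"
  by (simp_all add: edge_bound_def)

lemma tail_0_54: "tail 0.54 = cap 0.54"
  by (simp add: tail_def cap_def)

lemma tail_1: "tail 1 = 0"
  by (simp add: tail_def power_divide)

lemma tail_factor:
  "tail x = (0.2116 - (x - 0.54)\<^sup>2) * (2.3764 + 1.85 * (x - 0.54)\<^sup>2 + 2.6 * ((x - 0.54)\<^sup>2)\<^sup>2)"
proof -
  define W where "W = (x - 0.54)\<^sup>2"
  have "(x - 0.54) ^ 4 = W\<^sup>2" "(x - 0.54) ^ 6 = W ^ 3" by (simp_all add: W_def flip: power_mult)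
  then show ?thesis unfolding tail_def W_def[symmetric]
    by (simp add: power2_eq_square power3_eq_cube field_simps)
qed

lemma tail_nonneg:
  assumes "0.54 \<le> x" "x \<le> 1"
  shows "0 \<le> tail x"
proof -
  have "(x - 0.54)\<^sup>2 \<le> (0.46)\<^sup>2" using assms by (intro power_mono) auto
  then show ?thesis unfolding tail_factor by (intro mult_nonneg_nonneg) (auto simp: power2_eq_square)
qed

lemma tail_le: "tail x \<le> 0.50284624 - 1.98494 * (x - 0.54)\<^sup>2"
proof -
  have "0 \<le> 1.29984 * (x - 0.54) ^ 4 + 2.6 * (x - 0.54) ^ 6"
    by (intro add_nonneg_nonneg mult_nonneg_nonneg zero_le_even_power) simp_all
  then show ?thesis
    unfolding tail_def by (simp only: diff_diff_eq diff_le_eq le_add_same_cancel1 add.assoc)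
qed

lemma tail_square_ge:
  "0.50284624\<^sup>2 - 2 * 0.50284624 * 1.98494 * (x - 0.54)\<^sup>2 + 2.6327 * ((x - 0.54)\<^sup>2)\<^sup>2 \<le> (tail x)\<^sup>2"
proof -
  define W where "W = (x - 0.54)\<^sup>2"
  have W: "0 \<le> W" by (simp add: W_def)
  have p: "(x - 0.54) ^ 4 = W\<^sup>2" "(x - 0.54) ^ 6 = W ^ 3" by (simp_all add: W_def flip: power_mult)
  have "(tail x)\<^sup>2 - (0.50284624\<^sup>2 - 2 * 0.50284624 * 1.98494 * W + 2.6327 * W\<^sup>2)
    = (1.98494\<^sup>2 - 2 * 0.50284624 * 1.29984 - 2.6327) * W ^ 2
      + (2 * 1.98494 * 1.29984 - 2 * 0.50284624 * 2.6) * W ^ 3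
      + (1.29984\<^sup>2 + 2 * 1.98494 * 2.6) * W ^ 4 + 2 * 1.29984 * 2.6 * W ^ 5 + 2.6\<^sup>2 * W ^ 6"
    unfolding tail_def W_def[symmetric] p
    by (simp add: power2_eq_square power3_eq_cube eval_nat_numeral algebra_simps)
  also have "\<dots> \<ge> 0" using W by (intro add_nonneg_nonneg mult_nonneg_nonneg) (simp_all add: power2_eq_square)
  finally show ?thesis by (simp add: W_def)
qed

lemma cap_expand: "cap x = 1.921212 * x - 1.7789 * (x * x) - 0.015881"
  by (simp add: cap_def power2_eq_square algebra_simps)

lemma square_ge_tangent: "2 * a * x - a * a \<le> x * (x::real)"
  using sum_squares_bound[of a x] by (simp add: power2_eq_square)

lemma square_le_chord: "a \<le> x \<Longrightarrow> x \<le> b \<Longrightarrow> x * x \<le> (a + b) * x - a * (b::real)"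
  using mult_nonneg_nonneg[of "x - a" "b - x"] by (simp add: algebra_simps)

lemma cap_le_subcube_bound:
  assumes "0.08 \<le> x" "x \<le> 1/4"
  shows "cap x \<le> subcube_bound x"
proof -
  consider "x \<le> 1/8" | "1/8 \<le> x" "x \<le> 3/16" | "3/16 \<le> x" by linarith
  then show ?thesis
  proof cases
    case 1
    have "cap x \<le> 1/8 + (x - 1/16) * ((0.2165 - 1/8) / (1/8 - 1/16))"
      using assms 1 square_ge_tangent[of "0.1" x] unfolding cap_expand by (simp add: field_simps)
    also have "\<dots> \<le> subcube_bound x"
      using assms 1 subcube_bound_values by (intro subcube_bound_ge_chord) auto
    finally show ?thesis .
  next
    case 2
    have "cap x \<le> 0.2165 + (x - 1/8) * ((0.2913 - 0.2165) / (3/16 - 1/8))"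
      using assms 2 square_ge_tangent[of "0.16" x] unfolding cap_expand by (simp add: field_simps)
    also have "\<dots> \<le> subcube_bound x"
      using assms 2 subcube_bound_values by (intro subcube_bound_ge_chord) auto
    finally show ?thesis .
  next
    case 3
    have "cap x \<le> 0.2913 + (x - 3/16) * ((0.3535 - 0.2913) / (1/4 - 3/16))"
      using assms 3 square_ge_tangent[of "1/4" x] unfolding cap_expand by (simp add: field_simps)
    also have "\<dots> \<le> subcube_bound x"
      using assms 3 subcube_bound_values by (intro subcube_bound_ge_chord) auto
    finally show ?thesis .
  qed
qed

lemma subcube_bound_le_tangent_above:
  assumes "0 < c" "c \<le> x" "x \<le> 1" "log 2 (1 / c) \<le> L" "0 < l"
  shows "subcube_bound x \<le> (x * (L + l\<^sup>2) + (c - x) * 1.44) / (2 * l)"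
proof -
  have "(c - x) / ln 2 \<le> (c - x) * 1.44"
    using mult_left_mono_neg[of "1.44" "1 / ln 2" "c - x"] inverse_ln2_bounds assms by simp
  moreover have "subcube_bound x \<le> (x * (L + l\<^sup>2) + (c - x) / ln 2) / (2 * l)"
    using assms by (intro subcube_bound_le_tangent) auto
  ultimately show ?thesis
    using assms by (meson add_left_mono divide_right_mono order_trans mult_nonneg_nonneg less_imp_le zero_le_numeral)
qed

lemma subcube_bound_le_tangent_below:
  assumes "0 \<le> x" "x \<le> c" "c \<le> 1" "0 < c" "log 2 (1 / c) \<le> L" "0 < l"
  shows "subcube_bound x \<le> (x * (L + l\<^sup>2) + (c - x) * 1.45) / (2 * l)"
proof -
  have "(c - x) / ln 2 \<le> (c - x) * 1.45"
    using mult_left_mono[of "1 / ln 2" "1.45" "c - x"] inverse_ln2_bounds assms by simp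
  moreover have "subcube_bound x \<le> (x * (L + l\<^sup>2) + (c - x) / ln 2) / (2 * l)"
    using assms by (intro subcube_bound_le_tangent) auto
  ultimately show ?thesis
    using assms by (meson add_left_mono divide_right_mono order_trans mult_nonneg_nonneg less_imp_le zero_le_numeral)
qed

text \<open>Both functions agree at 1/2.  The tangents of \<open>subcube_bound\<close> at 1/4, 3/8 and 1/2 lie below
\<open>cap\<close> on the respective parts of the interval.\<close>
lemma subcube_bound_le_cap:
  assumes "0.255 \<le> x" "x \<le> 1/2"
  shows "subcube_bound x \<le> cap x"
proof -
  have log_8_3: "log 2 (1 / (3/8)) \<le> (17/12::real)"
    using log_2_3_bounds by (simp add: log_2_powers log_divide)
  consider "x \<le> 0.315" | "0.315 \<le> x" "x \<le> 3/8" | "3/8 \<le> x" "x \<le> 0.43" | "0.43 \<le> x" by linarith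
  then show ?thesis
  proof cases
    case 1
    have "subcube_bound x \<le> (x * (2 + 1.4142\<^sup>2) + (1/4 - x) * 1.44) / (2 * 1.4142)"
      using assms by (intro subcube_bound_le_tangent_above) (simp_all add: log_2_powers)
    also have "\<dots> \<le> cap x"
      using assms 1 square_le_chord[of "0.255" x "0.315"] unfolding cap_expand
      by (simp add: power2_eq_square field_simps)
    finally show ?thesis .
  next
    case 2
    have "subcube_bound x \<le> (x * (17/12 + 1.19\<^sup>2) + (3/8 - x) * 1.45) / (2 * 1.19)"
      using assms 2 log_8_3 by (intro subcube_bound_le_tangent_below) simp_all
    also have "\<dots> \<le> cap x"
      using 2 square_le_chord[of "0.315" x "3/8"] unfolding cap_expand
      by (simp add: power2_eq_square field_simps)
    finally show ?thesis .
  next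
    case 3
    have "subcube_bound x \<le> (x * (17/12 + 1.19\<^sup>2) + (3/8 - x) * 1.44) / (2 * 1.19)"
      using assms 3 log_8_3 by (intro subcube_bound_le_tangent_above) simp_all
    also have "\<dots> \<le> cap x"
      using 3 square_le_chord[of "3/8" x "0.43"] unfolding cap_expand
      by (simp add: power2_eq_square field_simps)
    finally show ?thesis .
  next
    case 4
    have "subcube_bound x \<le> (x * (1 + 1\<^sup>2) + (1/2 - x) * 1.45) / (2 * 1)"
      using assms by (intro subcube_bound_le_tangent_below) simp_all
    also have "\<dots> \<le> cap x"
      using 4 assms square_le_chord[of "0.43" x "1/2"] unfolding cap_expand
      by (simp add: power2_eq_square field_simps)
    finally show ?thesis .
  qed
qed

lemma subcube_bound_le_profile: "x \<le> 1/2 \<Longrightarrow> subcube_bound x \<le> profile x"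
  by (simp add: profile_def)

lemma cap_le_profile: "1/4 \<le> x \<Longrightarrow> x \<le> 0.54 \<Longrightarrow> cap x \<le> profile x"
  by (simp add: profile_def)

lemma cap_le_profile_from_chords: "0.08 \<le> x \<Longrightarrow> x \<le> 0.54 \<Longrightarrow> cap x \<le> profile x"
  using cap_le_subcube_bound[of x] cap_le_profile[of x] by (cases "x < 1/4") (simp_all add: profile_def)

lemma profile_eq_tail:
  assumes "0.54 \<le> x"
  shows "profile x = tail x"
proof (cases "x = 0.54")
  case True
  show ?thesis unfolding True using tail_0_54 by (simp add: profile_def)
next
  case False
  then have "0.54 < x" using assms by linarith
  then show ?thesis by (simp add: profile_def)
qed

lemma cap_nonneg:
  assumes "1/4 \<le> x" "x \<le> 0.54"
  shows "0 \<le> cap x"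
proof -
  have "(x - 0.54)\<^sup>2 \<le> (0.29)\<^sup>2" using assms by (intro abs_le_square_iff[THEN iffD1]) auto
  then show ?thesis unfolding cap_def by (simp add: power2_eq_square)
qed

lemma profile_nonneg: "0 \<le> x \<Longrightarrow> x \<le> 1 \<Longrightarrow> 0 \<le> profile x"
  using subcube_bound_nonneg[of x] cap_nonneg[of x] tail_nonneg[of x]
  by (auto simp: profile_def max.coboundedI1)

lemma profile_ends: "profile 0 = 0" "profile 1 = 0"
  using tail_1 by (simp_all add: profile_def)

section \<open>The two-point inequality for the profile\<close>

text \<open>With \<open>c\<close> the midpoint and \<open>m = J c\<close>, the difference of the two sides at the points
\<open>c - h\<close> and \<open>c + h\<close> is \<open>f0 h\<close> below; it vanishes together with its first derivative at
\<open>h = 0\<close>.  In the second derivative, the squares of \<open>J'\<close> contribute a nonnegative amount because \<open>J'\<close>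
is negative and decreasing, and the remaining terms do so because of \<open>J * J'' \<ge> -2\<close> and
\<open>J c \<le> J (c - h)\<close>.\<close>
lemma concave_two_point:
  fixes J J1 J2 :: "real \<Rightarrow> real"
  assumes "x \<le> y"
    and d1: "\<And>u. x \<le> u \<Longrightarrow> u \<le> y \<Longrightarrow> (J has_real_derivative J1 u) (at u)"
    and d2: "\<And>u. x \<le> u \<Longrightarrow> u \<le> y \<Longrightarrow> (J1 has_real_derivative J2 u) (at u)"
    and nonneg: "\<And>u. x \<le> u \<Longrightarrow> u \<le> y \<Longrightarrow> 0 \<le> J u"
    and decr: "\<And>u. x \<le> u \<Longrightarrow> u \<le> y \<Longrightarrow> J1 u \<le> 0"
    and conc: "\<And>u. x \<le> u \<Longrightarrow> u \<le> y \<Longrightarrow> J2 u \<le> 0"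
    and ode: "\<And>u. x \<le> u \<Longrightarrow> u \<le> y \<Longrightarrow> - 2 \<le> J u * J2 u"
  shows "(2 * J ((x + y) / 2) - J x)\<^sup>2 \<le> (y - x)\<^sup>2 + (J y)\<^sup>2"
proof -
  define c H m where "c = (x + y) / 2" and "H = (y - x) / 2" and "m = J c"
  have cH: "c + H = y" "c - H = x" "0 \<le> H" "2 * H = y - x"
    using assms(1) by (simp_all add: c_def H_def field_simps)
  have rng: "x \<le> c + h" "c + h \<le> y" "x \<le> c - h" "c - h \<le> y" "c - h \<le> c + h" "c - h \<le> c" "x \<le> c" "c \<le> y"
    if "0 \<le> h" "h \<le> H" for h using that cH by linarith+
  have dp: "((\<lambda>h. J (c + h)) has_real_derivative J1 (c + h)) (at h)"
      "((\<lambda>h. J1 (c + h)) has_real_derivative J2 (c + h)) (at h)"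
      "((\<lambda>h. J (c - h)) has_real_derivative - J1 (c - h)) (at h)"
      "((\<lambda>h. J1 (c - h)) has_real_derivative - J2 (c - h)) (at h)" if "0 \<le> h" "h \<le> H" for h
  proof -
    have g: "((\<lambda>h. c + h) has_real_derivative 1) (at h)" "((\<lambda>h. c - h) has_real_derivative - 1) (at h)"
      by (auto intro!: derivative_eq_intros)
    show "((\<lambda>h. J (c + h)) has_real_derivative J1 (c + h)) (at h)"
      using DERIV_chain2[OF d1 g(1)] rng[OF that] by simp
    show "((\<lambda>h. J1 (c + h)) has_real_derivative J2 (c + h)) (at h)"
      using DERIV_chain2[OF d2 g(1)] rng[OF that] by simp
    show "((\<lambda>h. J (c - h)) has_real_derivative - J1 (c - h)) (at h)"
      using DERIV_chain2[OF d1 g(2)] rng[OF that] by simp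
    show "((\<lambda>h. J1 (c - h)) has_real_derivative - J2 (c - h)) (at h)"
      using DERIV_chain2[OF d2 g(2)] rng[OF that] by simp
  qed
  define f0 where "f0 h = (J (c + h))\<^sup>2 - (J (c - h))\<^sup>2 + 4 * h\<^sup>2 - 4 * m * (m - J (c - h))" for h
  define f1 where "f1 h = 2 * J (c + h) * J1 (c + h) + 2 * J (c - h) * J1 (c - h) + 8 * h
    - 4 * m * J1 (c - h)" for h
  define f2 where "f2 h = 2 * ((J1 (c + h))\<^sup>2 + J (c + h) * J2 (c + h))
    - 2 * ((J1 (c - h))\<^sup>2 + J (c - h) * J2 (c - h)) + 8 + 4 * m * J2 (c - h)" for h
  have D0: "(f0 has_real_derivative f1 h) (at h)" if "0 \<le> h" "h \<le> H" for h
    unfolding f0_def f1_def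
    by (rule derivative_eq_intros dp[OF that] refl)+ (simp add: algebra_simps)
  have D1: "(f1 has_real_derivative f2 h) (at h)" if "0 \<le> h" "h \<le> H" for h
    unfolding f1_def f2_def
    by (rule derivative_eq_intros dp[OF that] refl)+ (simp add: power2_eq_square algebra_simps)
  have mono: "J v \<le> J u" "J1 v \<le> J1 u" if "x \<le> u" "u \<le> v" "v \<le> y" for u v
  proof -
    show "J v \<le> J u"
      by (rule DERIV_nonpos_imp_nonincreasing[OF that(2)]) (use that d1 decr in fastforce)
    show "J1 v \<le> J1 u"
      by (rule DERIV_nonpos_imp_nonincreasing[OF that(2)]) (use that d2 conc in fastforce)
  qed
  have f2: "0 \<le> f2 h" if h: "0 \<le> h" "h \<le> H" for h
  proof -
    note r = rng[OF h]
    have "(J1 (c - h))\<^sup>2 \<le> (J1 (c + h))\<^sup>2"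
      using mono(2)[of "c - h" "c + h"] decr[of "c - h"] decr[of "c + h"] r
      by (simp add: abs_le_square_iff[symmetric])
    moreover have "2 * J (c - h) * J2 (c - h) \<le> (4 * m - 2 * J (c - h)) * J2 (c - h)"
      using mono(1)[of "c - h" c] conc[of "c - h"] r
      by (intro mult_right_mono_neg) (auto simp: m_def)
    ultimately show ?thesis
      using ode[of "c - h"] ode[of "c + h"] r unfolding f2_def by (simp add: algebra_simps)
  qed
  have f1: "0 \<le> f1 h" if h: "0 \<le> h" "h \<le> H" for h
  proof -
    have "f1 0 \<le> f1 h"
      by (rule DERIV_nonneg_imp_nondecreasing[OF h(1)]) (use D1 f2 h in fastforce)
    then show ?thesis by (simp add: f1_def m_def)
  qed
  have "f0 0 \<le> f0 H"
    by (rule DERIV_nonneg_imp_nondecreasing[OF cH(3)]) (use D0 f1 in fastforce)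
  moreover have "f0 0 = 0" by (simp add: f0_def m_def)
  moreover have "f0 H = (J y)\<^sup>2 + (2 * H)\<^sup>2 - (2 * m - J x)\<^sup>2"
    unfolding f0_def cH(1,2) by (simp add: power2_eq_square algebra_simps)
  ultimately show ?thesis unfolding m_def c_def cH(4) by simp
qed

text \<open>Twice the lower bound for \<open>sqrt (e * m)\<close> that one induction step gives if the two sections have measures
\<open>x \<le> y\<close>.\<close>
definition lift_bound :: "real \<Rightarrow> real \<Rightarrow> real" where
  "lift_bound x y = sqrt ((y - x)\<^sup>2 + max ((profile y)\<^sup>2) ((y - x) * edge_bound y)) + profile x"

lemma lift_bound_profileI:
  assumes "(v - l)\<^sup>2 \<le> (y - x)\<^sup>2 + q" "l \<le> profile x" "q \<le> (profile y)\<^sup>2"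
  shows "v \<le> lift_bound x y"
proof -
  have "v - l \<le> sqrt ((y - x)\<^sup>2 + max ((profile y)\<^sup>2) ((y - x) * edge_bound y))"
    by (rule real_le_rsqrt) (use assms in linarith)
  then show ?thesis using assms by (simp add: lift_bound_def)
qed

lemma lift_bound_edgeI:
  assumes "(v - l)\<^sup>2 \<le> (y - x)\<^sup>2 + (y - x) * e" "l \<le> profile x" "e \<le> edge_bound y" "x \<le> y"
  shows "v \<le> lift_bound x y"
proof -
  have "(y - x) * e \<le> (y - x) * edge_bound y" using assms by (intro mult_left_mono) auto
  then have "v - l \<le> sqrt ((y - x)\<^sup>2 + max ((profile y)\<^sup>2) ((y - x) * edge_bound y))"
    by (intro real_le_rsqrt) (use assms in linarith)
  then show ?thesis using assms by (simp add: lift_bound_def)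
qed

lemma tail_square_ge_quadratic:
  "0.50284624\<^sup>2 - 2 * 0.50284624 * (1.98494 * (x - 0.54)\<^sup>2) \<le> (tail x)\<^sup>2"
proof -
  have "0 \<le> 2.6327 * ((x - 0.54)\<^sup>2)\<^sup>2" by simp
  then show ?thesis using tail_square_ge[of x] by (simp only: mult.assoc)
qed

lemma two_point_subcube:
  assumes "0 \<le> x" "x \<le> y" "y \<le> 1/2"
  shows "2 * subcube_bound ((x + y) / 2) \<le> lift_bound x y"
proof (rule lift_bound_profileI)
  show "(2 * subcube_bound ((x + y) / 2) - (2 * subcube_bound ((x + y) / 2)
      - sqrt ((y - x)\<^sup>2 + (subcube_bound y)\<^sup>2)))\<^sup>2 \<le> (y - x)\<^sup>2 + (subcube_bound y)\<^sup>2" by simp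
  show "2 * subcube_bound ((x + y) / 2) - sqrt ((y - x)\<^sup>2 + (subcube_bound y)\<^sup>2) \<le> profile x"
    using subcube_bound_two_point[OF assms] subcube_bound_le_profile[of x] assms by simp
  show "(subcube_bound y)\<^sup>2 \<le> (profile y)\<^sup>2"
    using assms subcube_bound_le_profile[of y] subcube_bound_nonneg[of y] by (intro power_mono) auto
qed

text \<open>The sections are close to measures 0 and 1/2, where equality holds for subcubes; the edge bound
\<open>1/2\<close> for the larger section is essential here.\<close>
lemma two_point_subcube_corner:
  assumes "0 \<le> x" "1/2 \<le> y" "x + y \<le> 0.51"
  shows "2 * subcube_bound ((x + y) / 2) \<le> lift_bound x y"
proof -
  define u d where "u = x + y" and "d = y - x"
  have u: "1/2 \<le> u" "u \<le> 0.51" and d: "d = u - 2 * x" "0.49 \<le> d" and x: "x \<le> 0.01"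
    using assms by (auto simp: u_def d_def)
  define R where "R = sqrt (d\<^sup>2 + d * (1/2))"
  have "0.69\<^sup>2 \<le> d\<^sup>2 + d * (1/2)"
    using power_mono[of "0.49" d 2] d(2) by (simp add: power2_eq_square)
  then have R: "0.69 \<le> R" unfolding R_def by (rule real_le_rsqrt)
  have R2: "R\<^sup>2 = d\<^sup>2 + d * (1/2)" using d unfolding R_def by simp
  have log: "log 2 (2 / u) \<le> 2 + 1.44 * (1 / (2 * u) - 1)"
  proof -
    have "log 2 (2 / u) = 2 + ln (1 / (2 * u)) / ln 2"
      using u by (simp add: log_def ln_div ln_mult field_simps)
    also have "ln (1 / (2 * u)) / ln 2 \<le> (1 / (2 * u) - 1) / ln 2"
      using u ln_le_minus_one[of "1 / (2 * u)"] by (intro divide_right_mono) auto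
    also have "\<dots> \<le> 1.44 * (1 / (2 * u) - 1)"
      using mult_right_mono_neg[of "1.44" "1 / ln 2" "1 / (2 * u) - 1"] inverse_ln2_bounds u by simp
    finally show ?thesis by simp
  qed
  have sub: "2 * subcube_bound ((x + y) / 2) = u * sqrt (log 2 (2 / u))"
    by (simp add: subcube_bound_def u_def)
  have lx: "2.236 * x \<le> subcube_bound x"
    by (rule subcube_bound_ge_linear[of _ 5]) (use assms x in \<open>simp_all add: power2_eq_square\<close>)
  have "u * sqrt (log 2 (2 / u)) \<le> R + 2.236 * x"
  proof (rule power2_le_imp_le)
    have "0 \<le> log 2 (2 / u)" using u by simp
    then have "(u * sqrt (log 2 (2 / u)))\<^sup>2 = u\<^sup>2 * log 2 (2 / u)" by (simp add: power_mult_distrib)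
    also have "\<dots> \<le> u\<^sup>2 * (2 + 1.44 * (1 / (2 * u) - 1))" using log by (intro mult_left_mono) auto
    also have "\<dots> = 0.56 * u * u + 0.72 * u" using u by (simp add: power2_eq_square field_simps)
    also have "\<dots> \<le> u * u + 0.5 * u"
      using mult_left_mono[of "1/2" u u] u by (simp add: field_simps)
    also have "\<dots> \<le> R\<^sup>2 + 2 * (2.236 * x) * R"
    proof -
      have "x * 0.69 \<le> x * R" using R assms by (intro mult_left_mono) auto
      moreover have "u * x \<le> 0.51 * x" using u assms by (intro mult_right_mono) auto
      ultimately have "x + 4 * (u * x) \<le> 559/125 * (x * R)" using assms(1) by simp
      moreover have "d\<^sup>2 + d * (1/2) = u * u + u / 2 - (x + 4 * (u * x)) + 4 * (x * x)"
        unfolding d(1) by (simp add: power2_eq_square field_simps)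
      moreover have "0 \<le> 4 * (x * x)" by simp
      moreover have "0.5 * u = u / 2" "2 * (2.236 * x) * R = 559/125 * (x * R)" by simp_all
      ultimately show ?thesis unfolding R2 by linarith
    qed
    also have "\<dots> \<le> (R + 2.236 * x)\<^sup>2" by (simp add: power2_sum)
    finally show "(u * sqrt (log 2 (2 / u)))\<^sup>2 \<le> (R + 2.236 * x)\<^sup>2" .
  qed (use R assms in auto)
  then have "2 * subcube_bound ((x + y) / 2) - R \<le> profile x"
    using lx sub subcube_bound_le_profile[of x] x by simp
  then show ?thesis
    by (rule lift_bound_edgeI[where e = "1/2", rotated])
       (use assms R2 d in \<open>auto simp: d_def edge_bound_def\<close>)
qed

text \<open>For a parabola with leading coefficient \<open>-k\<close> and \<open>d = y - x\<close>, the left side minus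
\<open>cap x\<close> equals \<open>cap y + k / 2 * d^2\<close>; the claim becomes \<open>k * cap y + (k * d / 2)^2 \<le> 1\<close>.\<close>
lemma two_point_cap_cap:
  assumes "3/16 \<le> x" "x \<le> y" "y \<le> 0.54" "1/4 \<le> y"
  shows "2 * cap ((x + y) / 2) \<le> lift_bound x y"
proof (rule lift_bound_profileI)
  define z w d where "z = 0.54 - x" and "w = 0.54 - y" and "d = z - w"
  have zw: "0 \<le> w" "w \<le> z" "z \<le> 0.3525" "0 \<le> d" "d \<le> z" using assms by (auto simp: z_def w_def d_def)
  have "d\<^sup>2 \<le> 0.3525\<^sup>2" using zw by (intro power_mono) auto
  then have "1.7789 * 0.50284624 + (1.7789 / 2)\<^sup>2 * d\<^sup>2 \<le> 1" by (simp add: power2_eq_square)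
  moreover have "1.7789 * cap y \<le> 1.7789 * 0.50284624" by (simp add: cap_def)
  ultimately have "d\<^sup>2 * (1.7789 * cap y + (1.7789 / 2)\<^sup>2 * d\<^sup>2) \<le> d\<^sup>2 * 1"
    by (intro mult_left_mono) auto
  moreover have v: "2 * cap ((x + y) / 2) - cap x = cap y + 1.7789 / 2 * d\<^sup>2"
  proof -
    have "cap x = 0.50284624 - 1.7789 * z\<^sup>2" "cap y = 0.50284624 - 1.7789 * w\<^sup>2"
      "cap ((x + y) / 2) = 0.50284624 - 1.7789 * ((z + w) / 2)\<^sup>2"
      unfolding cap_def z_def w_def by (simp_all add: power2_eq_square field_simps)
    then show ?thesis by (simp add: d_def power2_eq_square field_simps)
  qed
  moreover have yx: "y - x = d" by (simp add: z_def w_def d_def)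
  ultimately show "(2 * cap ((x + y) / 2) - cap x)\<^sup>2 \<le> (y - x)\<^sup>2 + (cap y)\<^sup>2"
    unfolding v yx by (simp add: power2_eq_square field_simps)
  show "cap x \<le> profile x" using assms by (intro cap_le_profile_from_chords) auto
  show "(cap y)\<^sup>2 \<le> (profile y)\<^sup>2"
    using assms cap_nonneg[of y] cap_le_profile[of y] by (intro power_mono) auto
qed

text \<open>Now \<open>2 * cap ((x + y) / 2) - cap x = M + k / 2 * g\<close> with \<open>M = 0.50284624\<close>, \<open>k = 1.7789\<close> and
\<open>g = z^2 + 2 * z * w - w^2\<close>.  If \<open>g\<close> is small, \<open>tail y\<close> suffices; if it is large, \<open>y\<close> is so
far above 5/8 that the edge bound does.\<close>
lemma two_point_cap_tail:
  assumes "1/4 \<le> x" "0.54 \<le> y" "x + y \<le> 1.08"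
  shows "2 * cap ((x + y) / 2) \<le> lift_bound x y"
proof -
  define z w where "z = 0.54 - x" and "w = y - 0.54"
  have zw: "0 \<le> w" "w \<le> z" "z \<le> 0.29" using assms by (auto simp: z_def w_def)
  define g where "g = z\<^sup>2 + 2 * z * w - w\<^sup>2"
  have v: "2 * cap ((x + y) / 2) - cap x = 0.50284624 + 0.88945 * g"
    unfolding cap_def z_def w_def g_def by (simp add: power2_eq_square field_simps)
  have yx: "y - x = w + z" by (simp add: z_def w_def)
  have g0: "0 \<le> g"
  proof -
    have "g = z * z + w * (2 * z - w)" by (simp add: g_def power2_eq_square algebra_simps)
    then show ?thesis using zw by simp
  qed
  have cap_x: "cap x \<le> profile x" using assms zw by (intro cap_le_profile) (auto simp: z_def)
  show ?thesis
  proof (cases "g \<le> 0.1333")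
    case True
    show ?thesis
    proof (rule lift_bound_profileI[OF _ cap_x])
      have "g * (0.88945\<^sup>2 * g) \<le> g * (1 - 2 * 0.50284624 * 0.88945)"
        using True g0 by (intro mult_left_mono) (auto simp: power2_eq_square)
      then have a: "(0.50284624 + 0.88945 * g)\<^sup>2 \<le> 0.50284624\<^sup>2 + g"
        by (simp add: power2_eq_square field_simps)
      have b: "g = (w + z)\<^sup>2 - 2 * w\<^sup>2" by (simp add: g_def power2_eq_square algebra_simps)
      have c: "2 * 0.50284624 * (1.98494 * w\<^sup>2) \<le> 2 * w\<^sup>2" by simp
      \<comment> \<open>Stated for variables, so that the decimal fractions stay opaque to linear arithmetic.\<close>
      have combine: "P \<le> A + (M - N)" if "P \<le> M + g" "g = A - B" "N \<le> B" for P A B M N :: real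
        using that by linarith
      show "(2 * cap ((x + y) / 2) - cap x)\<^sup>2
          \<le> (y - x)\<^sup>2 + (0.50284624\<^sup>2 - 2 * 0.50284624 * (1.98494 * (y - 0.54)\<^sup>2))"
        unfolding v yx w_def[symmetric] by (rule combine[OF a b c])
      show "0.50284624\<^sup>2 - 2 * 0.50284624 * (1.98494 * (y - 0.54)\<^sup>2) \<le> (profile y)\<^sup>2"
        using tail_square_ge_quadratic[of y] assms by (simp add: profile_eq_tail)
    qed
  next
    case False
    have z: "0.25 \<le> z"
    proof (rule ccontr)
      assume "\<not> 0.25 \<le> z"
      then have "z * z \<le> 0.25 * 0.25" using zw by (intro mult_mono) auto
      moreover have "g \<le> 2 * (z * z)"
        using zero_le_square[of "z - w"] by (simp add: g_def power2_eq_square algebra_simps)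
      ultimately show False using False by simp
    qed
    have w: "0.1 \<le> w"
    proof (rule ccontr)
      assume w: "\<not> 0.1 \<le> w"
      have "0 \<le> (0.1 - w) * (2 * z - w - 0.1)" using w zw z by (intro mult_nonneg_nonneg) auto
      moreover have "z * z \<le> 0.29 * z" using zw by (intro mult_right_mono) auto
      ultimately show False using False zw by (simp add: g_def power2_eq_square algebra_simps)
    qed
    show ?thesis
    proof (rule lift_bound_edgeI[OF _ cap_x])
      show "(2 * cap ((x + y) / 2) - cap x)\<^sup>2 \<le> (y - x)\<^sup>2 + (y - x) * (0.71 - w)"
      proof -
        have a: "(w + z)\<^sup>2 + (w + z) * (0.71 - w) = (w + z) * (z + 0.71)"
          by (simp add: power2_eq_square algebra_simps)
        have b: "0 \<le> (w + z) * (z + 0.71) - (0.50284624 + 0.88945 * g)\<^sup>2 - 0.6 * (g - 0.1333)"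
          unfolding g_def by (rule cap_edge_poly) (use w z zw in auto)
        have c: "0 \<le> 0.6 * (g - 0.1333)" using False by simp
        have combine: "P \<le> A" if "A = B" "0 \<le> B - P - N" "0 \<le> N" for P A B N :: real
          using that by linarith
        show ?thesis unfolding v yx by (rule combine[OF a b c])
      qed
      show "0.71 - w \<le> edge_bound y" using w zw by (simp add: edge_bound_def w_def)
      show "x \<le> y" using assms by simp
    qed
  qed
qed

text \<open>The second-order upper bound for \<open>tail\<close> at the midpoint and the lower bound for its square at \<open>y\<close>
reduce this case to \<open>cap_tail_poly\<close>.\<close>
lemma two_point_tail:
  assumes "0.08 \<le> x" "x \<le> 0.54" "1.08 \<le> x + y" "y \<le> 1"
  shows "2 * tail ((x + y) / 2) \<le> lift_bound x y"
proof -
  define z w where "z = 0.54 - x" and "w = y - 0.54"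
  have zw: "0 \<le> z" "z \<le> w" "w \<le> 0.46" using assms by (auto simp: z_def w_def)
  have yx: "y - x = w + z" by (simp add: z_def w_def)
  define v where "v = cap x + (0.50284624 - 0.99247 * (w - z)\<^sup>2 + 1.7789 * z\<^sup>2)"
  have "2 * tail ((x + y) / 2) \<le> v"
    using tail_le[of "(x + y) / 2"] unfolding v_def cap_def z_def w_def
    by (simp add: power2_eq_square field_simps)
  also have "v \<le> lift_bound x y"
  proof (rule lift_bound_profileI)
    show "(v - cap x)\<^sup>2 \<le> (y - x)\<^sup>2 + (tail y)\<^sup>2"
      using cap_tail_poly[OF zw] tail_square_ge[of y] by (simp add: v_def yx w_def)
    show "cap x \<le> profile x" using assms by (intro cap_le_profile_from_chords) auto
    show "(tail y)\<^sup>2 \<le> (profile y)\<^sup>2" using assms by (simp add: profile_eq_tail)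
  qed
  finally show ?thesis .
qed

lemma two_point_tail_tail:
  assumes "0.54 \<le> x" "x \<le> y" "y \<le> 1"
  shows "2 * tail ((x + y) / 2) \<le> lift_bound x y"
proof (rule lift_bound_profileI)
  define J1 where "J1 u = - (2 * 1.98494 * (u - 0.54) + 4 * 1.29984 * (u - 0.54) ^ 3
    + 6 * 2.6 * (u - 0.54) ^ 5)" for u :: real
  define J2 where "J2 u = - (2 * 1.98494 + 12 * 1.29984 * (u - 0.54)\<^sup>2
    + 30 * 2.6 * ((u - 0.54)\<^sup>2)\<^sup>2)" for u :: real
  show "(2 * tail ((x + y) / 2) - tail x)\<^sup>2 \<le> (y - x)\<^sup>2 + (tail y)\<^sup>2"
  proof (rule concave_two_point[of x y tail J1 J2])
    fix u assume u: "x \<le> u" "u \<le> y"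
    show "(tail has_real_derivative J1 u) (at u)"
      unfolding tail_def[abs_def] J1_def
      by (rule derivative_eq_intros refl)+ simp
    have e: "(u - 0.54) ^ 4 = ((u - 0.54)\<^sup>2)\<^sup>2" "(u - 0.54) ^ 6 = ((u - 0.54)\<^sup>2) ^ 3"
      by (simp_all flip: power_mult)
    show "(J1 has_real_derivative J2 u) (at u)"
      unfolding J1_def[abs_def] J2_def e(1)[symmetric]
      by (rule derivative_eq_intros refl)+ simp
    show "0 \<le> tail u" using u assms by (intro tail_nonneg) auto
    have "0 \<le> u - 0.54" using u assms by simp
    then show "J1 u \<le> 0" unfolding J1_def neg_le_0_iff_le
      by (intro add_nonneg_nonneg mult_nonneg_nonneg zero_le_power) simp_all
    show "J2 u \<le> 0" unfolding J2_def neg_le_0_iff_le by (intro add_nonneg_nonneg) simp_all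
    have "(u - 0.54)\<^sup>2 \<le> (0.46)\<^sup>2" using u assms by (intro power_mono) auto
    then have "(u - 0.54)\<^sup>2 \<le> 0.2116" by (simp add: power2_eq_square)
    from tail_ode_poly[OF _ this]
    have "(2 * 1.98494 + 12 * 1.29984 * (u - 0.54)\<^sup>2 + 30 * 2.6 * ((u - 0.54)\<^sup>2)\<^sup>2) * tail u \<le> 2"
      unfolding tail_def e by simp
    then show "- 2 \<le> tail u * J2 u"
      unfolding J2_def by (simp only: mult_minus_right neg_le_iff_le mult.commute[of "tail u"])
  qed (use assms in auto)
  show "tail x \<le> profile x" "(tail y)\<^sup>2 \<le> (profile y)\<^sup>2"
    using assms by (simp_all add: profile_eq_tail)
qed

lemma mem_segment: "x \<in> closed_segment a b \<longleftrightarrow> a \<le> x \<and> x \<le> b \<or> b \<le> x \<and> x \<le> (a::real)"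
  by (auto simp: closed_segment_eq_real_ivl)

lemma lift_bound_via_cap:
  assumes chk: "cap_check ds A B lo hi l (\<lambda>X Y. via_cap X Y)"
    and x: "\<And>s t. x \<in> closed_segment (pval A s t) (pval B s t)"
    and y: "\<And>X s t. pval X s t = x \<Longrightarrow> y \<in> closed_segment (pval (lo X) s t) (pval (hi X) s t)"
    and const: "\<And>s t. pval A s t = pval A 0 0" "\<And>s t. pval B s t = pval B 0 0"
      "\<And>X s t. pval X s t = pval X s 0 \<Longrightarrow> pval (lo X) s t = pval (lo X) s 0"
      "\<And>X s t. pval X s t = pval X s 0 \<Longrightarrow> pval (hi X) s t = pval (hi X) s 0"
    and l: "\<And>X s t. pval X s t = x \<Longrightarrow> pval (l X) s t \<le> profile x"
    and r: "1/4 \<le> y" "y \<le> 0.54"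
  shows "2 * cap ((x + y) / 2) \<le> lift_bound x y"
proof -
  obtain X Y s t where XY: "pval X s t = x" "pval Y s t = y"
    "(2 * cap ((x + y) / 2) - pval (l X) s t)\<^sup>2 \<le> pval (via_cap X Y) s t"
    by (rule cap_check_sound[OF chk x y const])
  show ?thesis
  proof (rule lift_bound_profileI[of _ "pval (l X) s t"])
    show "(2 * cap ((x + y) / 2) - pval (l X) s t)\<^sup>2 \<le> (y - x)\<^sup>2 + (cap y)\<^sup>2"
      using XY by (simp add: power2_eq_square)
    show "(cap y)\<^sup>2 \<le> (profile y)\<^sup>2"
      using r cap_nonneg[of y] cap_le_profile[of y] by (intro power_mono) auto
  qed (rule l[OF XY(1)])
qed

lemma lift_bound_via_tail:
  assumes chk: "cap_check ds A B lo hi l (\<lambda>X Y. via_tail X Y)"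
    and x: "\<And>s t. x \<in> closed_segment (pval A s t) (pval B s t)"
    and y: "\<And>X s t. pval X s t = x \<Longrightarrow> y \<in> closed_segment (pval (lo X) s t) (pval (hi X) s t)"
    and const: "\<And>s t. pval A s t = pval A 0 0" "\<And>s t. pval B s t = pval B 0 0"
      "\<And>X s t. pval X s t = pval X s 0 \<Longrightarrow> pval (lo X) s t = pval (lo X) s 0"
      "\<And>X s t. pval X s t = pval X s 0 \<Longrightarrow> pval (hi X) s t = pval (hi X) s 0"
    and l: "\<And>X s t. pval X s t = x \<Longrightarrow> pval (l X) s t \<le> profile x"
    and r: "0.54 \<le> y"
  shows "2 * cap ((x + y) / 2) \<le> lift_bound x y"
proof -
  obtain X Y s t where XY: "pval X s t = x" "pval Y s t = y"
    "(2 * cap ((x + y) / 2) - pval (l X) s t)\<^sup>2 \<le> pval (via_tail X Y) s t"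
    by (rule cap_check_sound[OF chk x y const])
  show ?thesis
  proof (rule lift_bound_profileI[of _ "pval (l X) s t"])
    show "(2 * cap ((x + y) / 2) - pval (l X) s t)\<^sup>2
        \<le> (y - x)\<^sup>2 + (0.50284624\<^sup>2 - 2 * 0.50284624 * (1.98494 * (y - 0.54)\<^sup>2))"
      using XY by (simp add: power2_eq_square)
    show "0.50284624\<^sup>2 - 2 * 0.50284624 * (1.98494 * (y - 0.54)\<^sup>2) \<le> (profile y)\<^sup>2"
      using tail_square_ge_quadratic[of y] r by (simp add: profile_eq_tail)
  qed (rule l[OF XY(1)])
qed

lemma lift_bound_via_edge:
  assumes chk: "cap_check ds A B lo hi l (\<lambda>X Y. via_edge (\<lambda>Y. E Y) X Y)"
    and x: "\<And>s t. x \<in> closed_segment (pval A s t) (pval B s t)"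
    and y: "\<And>X s t. pval X s t = x \<Longrightarrow> y \<in> closed_segment (pval (lo X) s t) (pval (hi X) s t)"
    and const: "\<And>s t. pval A s t = pval A 0 0" "\<And>s t. pval B s t = pval B 0 0"
      "\<And>X s t. pval X s t = pval X s 0 \<Longrightarrow> pval (lo X) s t = pval (lo X) s 0"
      "\<And>X s t. pval X s t = pval X s 0 \<Longrightarrow> pval (hi X) s t = pval (hi X) s 0"
    and l: "\<And>X s t. pval X s t = x \<Longrightarrow> pval (l X) s t \<le> profile x"
    and r: "\<And>Y s t. pval Y s t = y \<Longrightarrow> pval (E Y) s t \<le> edge_bound y" "x \<le> y"
  shows "2 * cap ((x + y) / 2) \<le> lift_bound x y"
proof -
  obtain X Y s t where XY: "pval X s t = x" "pval Y s t = y"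
    "(2 * cap ((x + y) / 2) - pval (l X) s t)\<^sup>2 \<le> pval (via_edge (\<lambda>Y. E Y) X Y) s t"
    by (rule cap_check_sound[OF chk x y const])
  show ?thesis
  proof (rule lift_bound_edgeI[of _ "pval (l X) s t"])
    show "(2 * cap ((x + y) / 2) - pval (l X) s t)\<^sup>2 \<le> (y - x)\<^sup>2 + (y - x) * pval (E Y) s t"
      using XY by (simp add: power2_eq_square)
  qed (rule l[OF XY(1)] r(1)[OF XY(2)] r(2))+
qed

text \<open>A section of measure below 1/4 is bounded below by a chord of \<open>subcube_bound\<close>; for the other
section, \<open>cap\<close>, \<open>tail\<close> or the edge bound is used according to its size.\<close>
lemma two_point_cap_small:
  assumes "0 \<le> x" "x \<le> 1/4" "1/2 \<le> x + y" "y \<le> 1"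
  shows "2 * cap ((x + y) / 2) \<le> lift_bound x y"
proof -
  have prof: "subcube_bound x \<le> profile x" using assms by (intro subcube_bound_le_profile) auto
  have edge: "5/8 \<le> y \<Longrightarrow> y \<le> 7/8 \<Longrightarrow> 5/4 - y \<le> edge_bound y" "7/8 \<le> y \<Longrightarrow> 3 - 3 * y \<le> edge_bound y"
    "1/2 \<le> y \<Longrightarrow> y \<le> 5/8 \<Longrightarrow> y \<le> edge_bound y"
    by (auto simp: edge_bound_def)
  consider (a) "x \<le> 1/16" | (b) "1/16 \<le> x" "x \<le> 1/8" | (c) "1/8 \<le> x" "x \<le> 3/16" | (d) "3/16 \<le> x"
    by linarith
  then show ?thesis
  proof cases
    case a
    have l: "2 * x \<le> profile x"
      using subcube_bound_ge_linear[of x 4 2] a assms prof by simp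
    consider "y \<le> 1/2 + x/2" | "1/2 + x/2 \<le> y" "y \<le> 5/8" | "5/8 \<le> y" "y \<le> 7/8" | "7/8 \<le> y"
      by linarith
    then show ?thesis
    proof cases
      case 1
      show ?thesis by (rule lift_bound_via_cap[OF cap_checks_chord1(1)]) (use a 1 l assms in \<open>simp_all add: mem_segment\<close>)
    next
      case 2
      show ?thesis by (rule lift_bound_via_edge[OF cap_checks_chord1(2)]) (use a 2 l assms edge in \<open>simp_all add: mem_segment\<close>)
    next
      case 3
      show ?thesis by (rule lift_bound_via_edge[OF cap_checks_chord1(3)]) (use a 3 l assms edge in \<open>simp_all add: mem_segment\<close>)
    next
      case 4
      show ?thesis by (rule lift_bound_via_edge[OF cap_checks_chord1(4)]) (use a 4 l assms edge in \<open>simp_all add: mem_segment\<close>)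
    qed
  next
    case b
    have "1/8 + (x - 1/16) * ((0.2165 - 1/8) / (1/8 - 1/16)) \<le> subcube_bound x"
      using b subcube_bound_values by (intro subcube_bound_ge_chord) auto
    then have "125 / 1000 + 1464 / 1000 * (x - 1/16) \<le> profile x"
      using prof by (simp add: algebra_simps)
    then have l: "pval (chord2 X) s t \<le> profile x" if "pval X s t = x" for X s t
      unfolding pval.simps that by simp
    consider "y \<le> 0.54" | "0.54 \<le> y" "y \<le> 0.57" | "0.57 \<le> y" "y \<le> 5/8" | "5/8 \<le> y" "y \<le> 7/8" | "7/8 \<le> y"
      by linarith
    then show ?thesis
    proof cases
      case 1
      show ?thesis by (rule lift_bound_via_cap[OF cap_checks_chord2(1) _ _ _ _ _ _ l]) (use b 1 assms in \<open>simp_all add: mem_segment\<close>)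
    next
      case 2
      show ?thesis by (rule lift_bound_via_tail[OF cap_checks_chord2(2) _ _ _ _ _ _ l]) (use b 2 assms in \<open>simp_all add: mem_segment\<close>)
    next
      case 3
      show ?thesis by (rule lift_bound_via_edge[OF cap_checks_chord2(3) _ _ _ _ _ _ l]) (use b 3 assms edge in \<open>simp_all add: mem_segment\<close>)
    next
      case 4
      show ?thesis by (rule lift_bound_via_edge[OF cap_checks_chord2(4) _ _ _ _ _ _ l]) (use b 4 assms edge in \<open>simp_all add: mem_segment\<close>)
    next
      case 5
      show ?thesis by (rule lift_bound_via_edge[OF cap_checks_chord2(5) _ _ _ _ _ _ l]) (use b 5 assms edge in \<open>simp_all add: mem_segment\<close>)
    qed
  next
    case c
    have "0.2165 + (x - 1/8) * ((0.2913 - 0.2165) / (3/16 - 1/8)) \<le> subcube_bound x"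
      using c subcube_bound_values by (intro subcube_bound_ge_chord) auto
    then have "2165 / 10000 + 11968 / 10000 * (x - 1/8) \<le> profile x"
      using prof by (simp add: algebra_simps)
    then have l: "pval (chord3 X) s t \<le> profile x" if "pval X s t = x" for X s t
      unfolding pval.simps that by simp
    consider "y \<le> 0.54" | "0.54 \<le> y" "y \<le> 5/8" | "5/8 \<le> y" "y \<le> 7/8" | "7/8 \<le> y"
      by linarith
    then show ?thesis
    proof cases
      case 1
      show ?thesis by (rule lift_bound_via_cap[OF cap_checks_chord3(1) _ _ _ _ _ _ l]) (use c 1 assms in \<open>simp_all add: mem_segment\<close>)
    next
      case 2
      show ?thesis by (rule lift_bound_via_tail[OF cap_checks_chord3(2) _ _ _ _ _ _ l]) (use c 2 assms in \<open>simp_all add: mem_segment\<close>)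
    next
      case 3
      show ?thesis by (rule lift_bound_via_edge[OF cap_checks_chord3(3) _ _ _ _ _ _ l]) (use c 3 assms edge in \<open>simp_all add: mem_segment\<close>)
    next
      case 4
      show ?thesis by (rule lift_bound_via_edge[OF cap_checks_chord3(4) _ _ _ _ _ _ l]) (use c 4 assms edge in \<open>simp_all add: mem_segment\<close>)
    qed
  next
    case d
    have "0.2913 + (x - 3/16) * ((0.3535 - 0.2913) / (1/4 - 3/16)) \<le> subcube_bound x"
      using d assms subcube_bound_values by (intro subcube_bound_ge_chord) auto
    then have "2913 / 10000 + 9952 / 10000 * (x - 3/16) \<le> profile x"
      using prof by (simp add: algebra_simps)
    then have l: "pval (chord4 X) s t \<le> profile x" if "pval X s t = x" for X s t
      unfolding pval.simps that by simp
    consider "y \<le> 0.54" | "0.54 \<le> y" "y \<le> 0.64" | "0.64 \<le> y" "y \<le> 7/8" | "7/8 \<le> y"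
      by linarith
    then show ?thesis
    proof cases
      case 1
      show ?thesis using d 1 assms by (intro two_point_cap_cap) auto
    next
      case 2
      show ?thesis by (rule lift_bound_via_tail[OF cap_checks_chord4(1) _ _ _ _ _ _ l]) (use d 2 assms in \<open>simp_all add: mem_segment\<close>)
    next
      case 3
      show ?thesis by (rule lift_bound_via_edge[OF cap_checks_chord4(2) _ _ _ _ _ _ l]) (use d 3 assms edge in \<open>simp_all add: mem_segment\<close>)
    next
      case 4
      show ?thesis by (rule lift_bound_via_edge[OF cap_checks_chord4(3) _ _ _ _ _ _ l]) (use d 4 assms edge in \<open>simp_all add: mem_segment\<close>)
    qed
  qed
qed

lemma two_point_cap:
  assumes "0 \<le> x" "x \<le> y" "y \<le> 1" "1/2 \<le> x + y" "x + y \<le> 1.08"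
  shows "2 * cap ((x + y) / 2) \<le> lift_bound x y"
proof -
  consider "x \<le> 1/4" | "1/4 \<le> x" "y \<le> 0.54" | "1/4 \<le> x" "0.54 \<le> y" by linarith
  then show ?thesis
  proof cases
    case 1
    then show ?thesis using assms by (intro two_point_cap_small) auto
  next
    case 2
    then show ?thesis using assms by (intro two_point_cap_cap) auto
  next
    case 3
    then show ?thesis using assms by (intro two_point_cap_tail) auto
  qed
qed

theorem profile_two_point:
  assumes "0 \<le> x" "x \<le> y" "y \<le> 1"
  shows "2 * profile ((x + y) / 2) \<le> lift_bound x y"
proof -
  define c where "c = (x + y) / 2"
  have xy: "x + y = 2 * c" by (simp add: c_def)
  consider (sub) "c < 1/4" | (mixed) "1/4 \<le> c" "c \<le> 1/2" | (cap) "1/2 < c" "c \<le> 0.54" | (tail) "0.54 < c"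
    by linarith
  then have "2 * profile c \<le> lift_bound x y"
  proof cases
    case sub
    then have "profile c = subcube_bound c" by (simp add: profile_def)
    then show ?thesis using two_point_subcube[of x y, folded c_def] sub xy assms by simp
  next
    case mixed
    have cap: "2 * cap c \<le> lift_bound x y"
      using two_point_cap[of x y, folded c_def] mixed xy assms by simp
    have "2 * subcube_bound c \<le> lift_bound x y"
    proof (cases "y \<le> 1/2")
      case True
      then show ?thesis using two_point_subcube[of x y, folded c_def] assms by simp
    next
      case False
      show ?thesis
      proof (cases "c \<le> 0.255")
        case True
        then show ?thesis
          using two_point_subcube_corner[of x y, folded c_def] False assms xy by simp
      next
        case c: False
        have "subcube_bound c \<le> cap c" using c mixed by (intro subcube_bound_le_cap) auto
        then show ?thesis using cap by simp
      qed
    qed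
    moreover have "profile c = max (subcube_bound c) (cap c)" using mixed by (simp add: profile_def)
    ultimately show ?thesis using cap by (simp add: max_def)
  next
    case cap
    then have "profile c = cap c" by (simp add: profile_def)
    then show ?thesis using two_point_cap[of x y, folded c_def] cap xy assms by simp
  next
    case tail
    then have p: "profile c = tail c" by (intro profile_eq_tail) auto
    show ?thesis
    proof (cases "x \<le> 0.54")
      case True
      then show ?thesis using two_point_tail[of x y, folded c_def] p tail xy assms by simp
    next
      case False
      then show ?thesis using two_point_tail_tail[of x y, folded c_def] p assms by simp
    qed
  qed
  then show ?thesis by (simp add: c_def)
qed

section \<open>Faces of the cube\<close>

lemma finite_hamming_cube [simp]: "finite (hamming_cube n)"
proof -
  have "hamming_cube n = {x. set x \<subseteq> UNIV \<and> length x = n}" by (simp add: hamming_cube_def)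
  then show ?thesis using finite_lists_length_eq[of "UNIV :: bool set" n] by simp
qed

lemma boundary_degree_eq_card_flips:
  assumes A: "A \<subseteq> hamming_cube n" and x: "x \<in> A"
  shows "boundary_degree n A x = card {i. i < n \<and> x[i := \<not> x ! i] \<notin> A}"
proof -
  have len: "length x = n" using assms by (auto simp: hamming_cube_def)
  let ?I = "{i. i < n \<and> x[i := \<not> x ! i] \<notin> A}"
  let ?f = "\<lambda>i. {x, x[i := \<not> x ! i]}"
  have flip_nth: "x[i := \<not> x ! i] ! j \<noteq> x ! j \<longleftrightarrow> j = i" if "i < n" "j < n" for i j
    using that len by (cases "i = j") auto
  have "{e \<in> hamming_edges n. \<exists>y \<in> hamming_cube n - A. e = {x, y}} = ?f ` ?I"
  proof (intro equalityI subsetI)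
    fix e assume "e \<in> {e \<in> hamming_edges n. \<exists>y \<in> hamming_cube n - A. e = {x, y}}"
    then obtain y x' y' where y: "y \<in> hamming_cube n" "y \<notin> A" "e = {x, y}"
      and e: "e = {x', y'}" "\<exists>!i. i < n \<and> x' ! i \<noteq> y' ! i"
      unfolding hamming_edges_def by blast
    have "(x' = x \<and> y' = y) \<or> (x' = y \<and> y' = x)"
      using y(3) e(1) by (metis doubleton_eq_iff)
    then have "\<exists>!i. i < n \<and> x ! i \<noteq> y ! i" using e(2) by (auto simp: eq_commute[of "y ! _"])
    then obtain i where i: "i < n" "x ! i \<noteq> y ! i" "\<And>j. j < n \<Longrightarrow> x ! j \<noteq> y ! j \<Longrightarrow> j = i"
      by blast
    have "y = x[i := \<not> x ! i]"
    proof (rule nth_equalityI)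
      show "length y = length (x[i := \<not> x ! i])" using y len by (simp add: hamming_cube_def)
    next
      fix j assume "j < length y"
      then have "j < n" using y by (simp add: hamming_cube_def)
      show "y ! j = x[i := \<not> x ! i] ! j"
      proof (cases "j = i")
        case True
        then show ?thesis using i(1,2) len by simp
      next
        case False
        then show ?thesis using i(3)[OF \<open>j < n\<close>] by auto
      qed
    qed
    then have "i \<in> ?I" "e = ?f i" using i(1) y(2,3) by simp_all
    then show "e \<in> ?f ` ?I" by (rule rev_image_eqI)
  next
    fix e assume "e \<in> ?f ` ?I"
    then obtain i where i: "i < n" "x[i := \<not> x ! i] \<notin> A" "e = {x, x[i := \<not> x ! i]}" by auto
    have flip: "x[i := \<not> x ! i] \<in> hamming_cube n" using len by (simp add: hamming_cube_def)
    have "\<exists>!j. j < n \<and> x ! j \<noteq> x[i := \<not> x ! i] ! j"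
      by (rule ex1I[of _ i]) (use flip_nth[OF i(1)] i(1) in metis)+
    then have "e \<in> hamming_edges n"
      using i(3) flip x A unfolding hamming_edges_def by blast
    then show "e \<in> {e \<in> hamming_edges n. \<exists>y \<in> hamming_cube n - A. e = {x, y}}"
      using i(2,3) flip by blast
  qed
  moreover have "inj_on ?f ?I"
  proof (rule inj_onI)
    fix i j assume ij: "i \<in> ?I" "j \<in> ?I" "?f i = ?f j"
    then have "x[i := \<not> x ! i] = x[j := \<not> x ! j]" by (metis doubleton_eq_iff)
    then show "i = j" using flip_nth[of i i] flip_nth[of j i] ij(1,2) by simp
  qed
  ultimately show ?thesis using x by (simp add: boundary_degree_def card_image)
qed

definition face :: "bool \<Rightarrow> bool list set \<Rightarrow> bool list set" where
  "face b A = {x. b # x \<in> A}"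

lemma face_subset: "A \<subseteq> hamming_cube (Suc n) \<Longrightarrow> face b A \<subseteq> hamming_cube n"
  by (auto simp: face_def hamming_cube_def)

lemma sum_over_faces:
  fixes g :: "bool list \<Rightarrow> 'a::comm_monoid_add"
  assumes "A \<subseteq> hamming_cube (Suc n)"
  shows "(\<Sum>x\<in>A. g x) = (\<Sum>x\<in>face b A. g (b # x)) + (\<Sum>x\<in>face (\<not> b) A. g ((\<not> b) # x))"
proof -
  have fin: "finite (face c A)" for c
    using face_subset[OF assms] finite_subset finite_hamming_cube by blast
  have "A = (#) b ` face b A \<union> (#) (\<not> b) ` face (\<not> b) A" (is "_ = ?L \<union> ?R")
  proof (intro equalityI subsetI)
    fix x assume "x \<in> A"
    then obtain c y where "x = c # y" using assms by (cases x) (auto simp: hamming_cube_def)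
    then show "x \<in> ?L \<union> ?R" using \<open>x \<in> A\<close> by (cases "c = b") (auto simp: face_def)
  qed (auto simp: face_def)
  then have "(\<Sum>x\<in>A. g x) = (\<Sum>x\<in>?L \<union> ?R. g x)" by simp
  also have "\<dots> = (\<Sum>x\<in>?L. g x) + (\<Sum>x\<in>?R. g x)"
    using fin by (intro sum.union_disjoint) auto
  finally show ?thesis by (simp add: sum.reindex inj_on_def)
qed

lemma card_faces:
  assumes "A \<subseteq> hamming_cube (Suc n)"
  shows "card A = card (face b A) + card (face (\<not> b) A)"
  using sum_over_faces[OF assms, of "\<lambda>_. 1::nat" b] by simp

lemma boundary_degree_Cons:
  assumes A: "A \<subseteq> hamming_cube (Suc n)" and x: "b # x \<in> A"
  shows "boundary_degree (Suc n) A (b # x)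
    = boundary_degree n (face b A) x + (if x \<in> face (\<not> b) A then 0 else 1)"
proof -
  let ?P = "\<lambda>i. (b # x)[i := \<not> (b # x) ! i] \<notin> A"
  let ?Q = "\<lambda>i. x[i := \<not> x ! i] \<notin> face b A"
  have split: "{i. i < Suc n \<and> ?P i} = {i. i = 0 \<and> x \<notin> face (\<not> b) A} \<union> Suc ` {i. i < n \<and> ?Q i}"
  proof (intro equalityI subsetI)
    fix i assume "i \<in> {i. i < Suc n \<and> ?P i}"
    then show "i \<in> {i. i = 0 \<and> x \<notin> face (\<not> b) A} \<union> Suc ` {i. i < n \<and> ?Q i}"
      by (cases i) (auto simp: face_def)
  qed (auto simp: face_def)
  have "card {i. i < Suc n \<and> ?P i}
      = card {i. i = (0::nat) \<and> x \<notin> face (\<not> b) A} + card (Suc ` {i. i < n \<and> ?Q i})"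
    unfolding split by (intro card_Un_disjoint) auto
  also have "\<dots> = (if x \<in> face (\<not> b) A then 0 else 1) + card {i. i < n \<and> ?Q i}"
    by (simp add: card_image)
  finally show ?thesis
    using boundary_degree_eq_card_flips[OF A x]
      boundary_degree_eq_card_flips[OF face_subset[OF A], of x b] x
    by (simp add: face_def)
qed

definition boundary_edges :: "nat \<Rightarrow> bool list set \<Rightarrow> nat" where
  "boundary_edges n A = (\<Sum>x\<in>A. boundary_degree n A x)"

lemma boundary_edges_faces:
  assumes A: "A \<subseteq> hamming_cube (Suc n)"
  shows "boundary_edges n (face b A) + boundary_edges n (face (\<not> b) A)
      + card (face b A - face (\<not> b) A) \<le> boundary_edges (Suc n) A"
proof -
  have fin: "finite (face c A)" for c
    using face_subset[OF A] finite_subset finite_hamming_cube by blast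
  have *: "(\<Sum>x\<in>face c A. boundary_degree (Suc n) A (c # x))
      = boundary_edges n (face c A) + card (face c A - face (\<not> c) A)" for c
  proof -
    have "(\<Sum>x\<in>face c A. boundary_degree (Suc n) A (c # x))
        = (\<Sum>x\<in>face c A. boundary_degree n (face c A) x + (if x \<in> face (\<not> c) A then 0 else 1))"
      by (intro sum.cong refl boundary_degree_Cons[OF A]) (simp add: face_def)
    also have "\<dots> = boundary_edges n (face c A) + (\<Sum>x\<in>face c A. if x \<in> face (\<not> c) A then 0 else 1)"
      by (simp add: sum.distrib boundary_edges_def)
    also have "(\<Sum>x\<in>face c A. if x \<in> face (\<not> c) A then 0 else 1) = card (face c A - face (\<not> c) A)"
    proof -
      have "(\<Sum>x\<in>face c A. if x \<in> face (\<not> c) A then 0 else 1)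
          = (\<Sum>x\<in>face c A - face (\<not> c) A. 1::nat)"
        by (rule sum.mono_neutral_cong_right) (use fin in auto)
      then show ?thesis by simp
    qed
    finally show ?thesis .
  qed
  have "boundary_edges (Suc n) A = (\<Sum>x\<in>face b A. boundary_degree (Suc n) A (b # x))
      + (\<Sum>x\<in>face (\<not> b) A. boundary_degree (Suc n) A ((\<not> b) # x))"
    unfolding boundary_edges_def by (rule sum_over_faces[OF A])
  then show ?thesis unfolding * by linarith
qed

text \<open>Besides the boundary points of a section, every point of the section without a counterpart in the opposite
one is a boundary point.\<close>
lemma vertex_boundary_faces:
  assumes A: "A \<subseteq> hamming_cube (Suc n)"
  shows "max (card (vertex_boundary n (face b A))) (card (face b A - face (\<not> b) A))
      + card (vertex_boundary n (face (\<not> b) A)) \<le> card (vertex_boundary (Suc n) A)"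
proof -
  let ?V = "vertex_boundary (Suc n) A"
  have V: "?V \<subseteq> hamming_cube (Suc n)" by (auto simp: vertex_boundary_def)
  have fin: "finite (face c ?V)" for c
    using face_subset[OF V] finite_subset finite_hamming_cube by blast
  have in_A: "x \<in> face c A" if "x \<in> vertex_boundary n (face c A)" for c x
    using that by (auto simp: vertex_boundary_def boundary_degree_def split: if_splits)
  have "vertex_boundary n (face c A) \<subseteq> face c ?V" for c
    using in_A[of _ c] boundary_degree_Cons[OF A, of c]
    by (auto simp: vertex_boundary_def face_def hamming_cube_def)
  then have 1: "card (vertex_boundary n (face c A)) \<le> card (face c ?V)" for c
    using fin by (intro card_mono) auto
  have "face b A - face (\<not> b) A \<subseteq> face b ?V"
    using boundary_degree_Cons[OF A, of b] A
    by (auto simp: vertex_boundary_def face_def)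
  then have 2: "card (face b A - face (\<not> b) A) \<le> card (face b ?V)"
    using fin by (intro card_mono) auto
  show ?thesis
    unfolding card_faces[OF V, of b] by (intro add_mono max.boundedI 1 2)
qed

section \<open>The induction\<close>

lemma sqrt_mult_superadditive:
  fixes a b c d :: real
  assumes "0 \<le> a" "0 \<le> b" "0 \<le> c" "0 \<le> d"
  shows "sqrt (a * b) + sqrt (c * d) \<le> sqrt ((a + c) * (b + d))"
proof (rule real_le_rsqrt)
  have "0 \<le> (sqrt (a * d) - sqrt (b * c))\<^sup>2" by simp
  then have "2 * (sqrt (a * d) * sqrt (b * c)) \<le> a * d + b * c"
    using assms by (simp add: power2_diff)
  moreover have "sqrt (a * d) * sqrt (b * c) = sqrt (a * b) * sqrt (c * d)"
    by (simp add: real_sqrt_mult)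
  ultimately show "(sqrt (a * b) + sqrt (c * d))\<^sup>2 \<le> (a + c) * (b + d)"
    using assms by (simp add: power2_sum algebra_simps)
qed

text \<open>With \<open>d = y - x\<close>, the number \<open>max m0 d\<close> is at least \<open>m0\<close> and at least \<open>d\<close>, which gives
\<open>(e0 + d) * max m0 d \<ge> e0 * m0 + d^2\<close> and \<open>\<ge> e0 * d + d^2\<close>.\<close>
lemma induction_step:
  fixes e0 e1 m0 m1 x y :: real
  assumes "0 \<le> x" "x \<le> y" "y \<le> 1" "0 \<le> e0" "0 \<le> e1" "0 \<le> m0" "0 \<le> m1"
    and IH: "edge_bound y \<le> e0" "(profile y)\<^sup>2 \<le> e0 * m0" "(profile x)\<^sup>2 \<le> e1 * m1"
    and e: "e0 + e1 + (y - x) \<le> 2 * e" and m: "max m0 (y - x) + m1 \<le> 2 * m"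
  shows "(profile ((x + y) / 2))\<^sup>2 \<le> e * m"
proof -
  define d M where "d = y - x" and "M = max m0 d"
  have d: "0 \<le> d" and M: "m0 \<le> M" "d \<le> M" "0 \<le> M" using assms by (auto simp: d_def M_def)
  \<comment> \<open>\<open>max m0 d\<close> is used in both roles: as a bound for \<open>m0\<close> and as one for \<open>d\<close>.\<close>
  have "(profile y)\<^sup>2 \<le> e0 * M"
    using IH(2) mult_left_mono[OF M(1) assms(4)] by linarith
  moreover have "d * edge_bound y \<le> e0 * M"
    using mult_mono[of "edge_bound y" e0 d M] IH(1) M d assms(4) by (simp add: mult.commute)
  moreover have "d\<^sup>2 \<le> d * M" using mult_left_mono[OF M(2) d] by (simp add: power2_eq_square)
  ultimately have "sqrt (d\<^sup>2 + max ((profile y)\<^sup>2) (d * edge_bound y)) \<le> sqrt ((e0 + d) * M)"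
    by (intro real_sqrt_le_mono) (simp add: algebra_simps)
  moreover have "profile x \<le> sqrt (e1 * m1)" using IH(3) by (rule real_le_rsqrt)
  ultimately have "2 * profile ((x + y) / 2) \<le> sqrt ((e0 + d) * M) + sqrt (e1 * m1)"
    using profile_two_point[OF assms(1-3)] unfolding lift_bound_def d_def by linarith
  also have "\<dots> \<le> sqrt ((e0 + d + e1) * (M + m1))"
    using assms d M by (intro sqrt_mult_superadditive) auto
  also have "\<dots> \<le> sqrt ((2 * e) * (2 * m))"
    using assms d M e m by (intro real_sqrt_le_mono mult_mono) (auto simp: d_def M_def)
  finally have "2 * profile ((x + y) / 2) \<le> 2 * sqrt (e * m)"
    by (simp add: real_sqrt_mult)
  moreover have "0 \<le> profile ((x + y) / 2)" using assms by (intro profile_nonneg) auto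
  moreover have "0 \<le> e * m" using assms d M e m by (intro mult_nonneg_nonneg) (auto simp: d_def M_def)
  ultimately show ?thesis using power_mono[of "profile ((x + y) / 2)" "sqrt (e * m)" 2] by simp
qed

text \<open>The edge bound has to be carried along, since the product bound alone loses too much when the smaller section is
empty: then every point of the larger section is a boundary point, and only its edges count.\<close>
lemma isoperimetry:
  assumes "A \<subseteq> hamming_cube n"
  shows "edge_bound (card A / 2 ^ n) \<le> boundary_edges n A / 2 ^ n \<and>
    (profile (card A / 2 ^ n))\<^sup>2 \<le> boundary_edges n A / 2 ^ n * (card (vertex_boundary n A) / 2 ^ n)"
  using assms
proof (induction n arbitrary: A)
  case 0
  then have "A = {} \<or> A = {[]}" by (auto simp: hamming_cube_def)
  then have "card A = 0 \<or> card A = 1" by auto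
  then show ?case by (auto simp: edge_bound_ends profile_ends)
next
  case (Suc n)
  obtain b where b: "card (face (\<not> b) A) \<le> card (face b A)"
    using nat_le_linear[of "card (face True A)" "card (face False A)"] that[of False] that[of True]
    by auto
  define y x where "y = card (face b A) / 2 ^ n" and "x = card (face (\<not> b) A) / 2 ^ n"
  define e0 e1 where "e0 = boundary_edges n (face b A) / 2 ^ n"
    and "e1 = boundary_edges n (face (\<not> b) A) / 2 ^ n"
  define m0 m1 where "m0 = card (vertex_boundary n (face b A)) / 2 ^ n"
    and "m1 = card (vertex_boundary n (face (\<not> b) A)) / 2 ^ n"
  define e m where "e = boundary_edges (Suc n) A / 2 ^ Suc n"
    and "m = card (vertex_boundary (Suc n) A) / 2 ^ Suc n"
  have fin: "finite (face c A)" for c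
    using face_subset[OF Suc.prems] finite_subset finite_hamming_cube by blast
  have "card (hamming_cube n) = 2 ^ n"
    using card_lists_length_eq[of "UNIV :: bool set" n] by (simp add: hamming_cube_def)
  then have "card (face b A) \<le> 2 ^ n"
    using card_mono[OF finite_hamming_cube face_subset[OF Suc.prems]] by metis
  then have xy: "0 \<le> x" "x \<le> y" "y \<le> 1"
    using b by (simp_all add: x_def y_def divide_right_mono)
  have "card (face b A) \<le> card (face b A - face (\<not> b) A) + card (face (\<not> b) A)"
    using card_Un_le[of "face b A - face (\<not> b) A" "face (\<not> b) A"]
      card_mono[of "(face b A - face (\<not> b) A) \<union> face (\<not> b) A" "face b A"] fin by force
  then have "real (card (face b A)) - card (face (\<not> b) A) \<le> card (face b A - face (\<not> b) A)"
    by simp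
  then have d: "y - x \<le> card (face b A - face (\<not> b) A) / 2 ^ n"
    by (simp add: x_def y_def divide_right_mono flip: diff_divide_distrib)
  have "e0 + e1 + card (face b A - face (\<not> b) A) / 2 ^ n
      = real (boundary_edges n (face b A) + boundary_edges n (face (\<not> b) A)
          + card (face b A - face (\<not> b) A)) / 2 ^ n"
    by (simp add: e0_def e1_def add_divide_distrib)
  also have "\<dots> \<le> real (boundary_edges (Suc n) A) / 2 ^ n"
    by (intro divide_right_mono of_nat_mono boundary_edges_faces[OF Suc.prems]) simp
  also have "\<dots> = 2 * e" by (simp add: e_def)
  finally have "e0 + e1 + card (face b A - face (\<not> b) A) / 2 ^ n \<le> 2 * e" .
  then have e: "e0 + e1 + (y - x) \<le> 2 * e" using d by linarith
  have "max m0 (card (face b A - face (\<not> b) A) / 2 ^ n) + m1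
      = real (max (card (vertex_boundary n (face b A))) (card (face b A - face (\<not> b) A))
          + card (vertex_boundary n (face (\<not> b) A))) / 2 ^ n"
    by (simp add: m0_def m1_def max_divide_distrib_right add_divide_distrib of_nat_max)
  also have "\<dots> \<le> real (card (vertex_boundary (Suc n) A)) / 2 ^ n"
    by (intro divide_right_mono of_nat_mono vertex_boundary_faces[OF Suc.prems]) simp
  also have "\<dots> = 2 * m" by (simp add: m_def)
  finally have "max m0 (card (face b A - face (\<not> b) A) / 2 ^ n) + m1 \<le> 2 * m" .
  then have m: "max m0 (y - x) + m1 \<le> 2 * m" using d by linarith
  have a: "card A / 2 ^ Suc n = (x + y) / 2"
    using card_faces[OF Suc.prems, of b] by (simp add: x_def y_def field_simps)
  note IH = Suc.IH[OF face_subset[OF Suc.prems], of b, folded y_def e0_def m0_def]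
    Suc.IH[OF face_subset[OF Suc.prems], of "\<not> b", folded x_def e1_def m1_def]
  have "(profile ((x + y) / 2))\<^sup>2 \<le> e * m"
    by (rule induction_step[OF xy _ _ _ _ _ _ _ e m])
       (use IH in \<open>simp_all add: e0_def e1_def m0_def m1_def\<close>)
  moreover have "edge_bound ((x + y) / 2) \<le> e"
    using edge_bound_two_point[OF xy] IH e by linarith
  ultimately show ?case unfolding a by (simp add: e_def m_def)
qed

lemma cube_expectation_boundary_degree:
  assumes "A \<subseteq> hamming_cube n"
  shows "cube_expectation n (\<lambda>x. real (boundary_degree n A x)) = boundary_edges n A / 2 ^ n"
proof -
  have "(\<Sum>x\<in>hamming_cube n. real (boundary_degree n A x)) = (\<Sum>x\<in>A. real (boundary_degree n A x))"
    using assms by (intro sum.mono_neutral_right) (auto simp: boundary_degree_def)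
  then show ?thesis by (simp add: cube_expectation_def boundary_edges_def)
qed

lemma cube_measure_eq_card:
  assumes "A \<subseteq> hamming_cube n"
  shows "cube_measure n A = card A / 2 ^ n"
proof -
  have "(\<Sum>x\<in>hamming_cube n. indicat_real A x) = (\<Sum>x\<in>A. 1)"
    using assms by (intro sum.mono_neutral_cong_right) auto
  then show ?thesis by (simp add: cube_measure_def cube_expectation_def)
qed

theorem mainTheorem4:
  fixes n :: nat and A :: "bool list set"
  assumes "n \<ge> 1"
    and "A \<subseteq> hamming_cube n"
    and "A \<noteq> {}"
    and "cube_measure n A \<le> 1 / 2"
  shows "cube_expectation n (\<lambda>x. real (boundary_degree n A x))
    \<ge> cube_measure n A / cube_measure n (vertex_boundary n A)
        * (cube_measure n A * log 2 (1 / cube_measure n A))"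
proof -
  define a e m where "a = cube_measure n A" and "e = boundary_edges n A / 2 ^ n"
    and "m = cube_measure n (vertex_boundary n A)"
  have V: "vertex_boundary n A \<subseteq> hamming_cube n" by (auto simp: vertex_boundary_def)
  have a: "0 \<le> a" "a \<le> 1/2" using assms by (simp_all add: a_def cube_measure_eq_card)
  have "(subcube_bound a)\<^sup>2 \<le> (profile a)\<^sup>2"
    using a subcube_bound_le_profile[of a] subcube_bound_nonneg[of a] by (intro power_mono) auto
  also have "\<dots> \<le> e * m"
    using isoperimetry[OF assms(2)] assms(2) V by (simp add: a_def e_def m_def cube_measure_eq_card)
  finally have "a\<^sup>2 * log 2 (1 / a) \<le> e * m"
    using a log_inverse_nonneg[of a] by (simp add: subcube_bound_def power_mult_distrib)
  moreover have "0 \<le> m" "0 \<le> e" using V by (simp_all add: m_def e_def cube_measure_eq_card)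
  ultimately have "a / m * (a * log 2 (1 / a)) \<le> e"
    by (cases "m = 0") (simp_all add: field_simps power2_eq_square)
  then show ?thesis
    using assms(2) by (simp add: cube_expectation_boundary_degree a_def e_def m_def)
qed

end
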